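(* Let $K\subset\mathbb{R}^2$ be a compact convex set with boundary of class $\mathcal{C}^2$, having the origin as an interior point, and let $m\ge 3$ be an integer. Then $$2\int_{P\notin K}\sin^m(\omega)\,dP=\int_{G_i\cap K\neq\emptyset}\Bigl(m(m-1)\,|\sin^{m-3}(\varphi_2-\varphi_1)|-m^2\,|\sin^{m-1}(\varphi_2-\varphi_1)|\Bigr)\,dG_1\,dG_2.$$
   Context: For $P\notin K$, $\omega=\omega(P)\in(0,\pi)$ is the visual angle of $K$ from $P$, i.e. the angle between the two tangents from $P$ to the boundary of $K$ (the angle at $P$ of the sector with vertex $P$ containing $K$), and $dP$ is the area element of the plane. For $m=3$, $\sin^{0}$ means the constant $1$. A line $G\subset\mathbb{R}^2$ not passing through the origin is given coordinates $(p,\varphi)$, $p>0$, $0\le\varphi<2\pi$, which are the polar coordinates of the point of $G$ at minimum distance from the origin (lines through the origin form a null set and are disregarded). $dG=dp\,d\varphi$, and ordered pairs of lines $(G_1,G_2)$, with coordinates $(p_i,\varphi_i)$, carry the measure $dG_1\,dG_2=dp_1\,d\varphi_1\,dp_2\,d\varphi_2$. The integral over $G_i\cap K\neq\emptyset$ is over all ordered pairs $(G_1,G_2)$ such that both $G_1$ and $G_2$ meet $K$. *)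

theory Defs
  imports "HOL-Analysis.Analysis"
begin

text \<open>The boundary is a simple closed curve with a regular \<open>1\<close>-periodic \<open>C\<^sup>2\<close> parametrization;
  periodicity on the whole line makes the two ends of \<open>\<gamma>\<close> on \<open>[0,1]\<close> fit together to second order.\<close>

definition C2_boundary :: "(real^2) set \<Rightarrow> bool" where
  "C2_boundary K \<longleftrightarrow>
     (\<exists>\<gamma> \<gamma>' \<gamma>''.
        (\<forall>t. (\<gamma> has_vector_derivative \<gamma>' t) (at t)) \<and>
        (\<forall>t. (\<gamma>' has_vector_derivative \<gamma>'' t) (at t)) \<and>
        continuous_on UNIV \<gamma>'' \<and>
        (\<forall>t. \<gamma>' t \<noteq> 0) \<and>
        (\<forall>t. \<gamma> (t + 1) = \<gamma> t) \<and>
        simple_path \<gamma> \<and>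
        path_image \<gamma> = frontier K)"

definition vec_angle :: "real^2 \<Rightarrow> real^2 \<Rightarrow> real" where
  "vec_angle u v = arccos ((u \<bullet> v) / (norm u * norm v))"

definition sector :: "real^2 \<Rightarrow> real^2 \<Rightarrow> real^2 \<Rightarrow> (real^2) set" where
  "sector P u v = {P + s *\<^sub>R u + t *\<^sub>R v | s t. 0 \<le> s \<and> 0 \<le> t}"

text \<open>The points \<open>A\<close> and \<open>B\<close> are points of contact of the two tangents from \<open>P\<close>: the rays
  \<open>PA\<close> and \<open>PB\<close> touch \<open>K\<close> and bound a sector containing \<open>K\<close>, so both lines \<open>PA\<close> and \<open>PB\<close>
  support \<open>K\<close>. If \<open>K\<close> is compact and convex with nonempty interior and \<open>P \<notin> K\<close>, this sector is
  the convex cone at \<open>P\<close> generated by \<open>K\<close>; hence its angle is unique and lies in \<open>(0, \<pi>)\<close>.\<close>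

definition visual_angle :: "(real^2) set \<Rightarrow> real^2 \<Rightarrow> real" where
  "visual_angle K P =
     (THE \<omega>. \<exists>A\<in>frontier K. \<exists>B\<in>frontier K.
        K \<subseteq> sector P (A - P) (B - P) \<and> \<omega> = vec_angle (A - P) (B - P))"

definition line_coords :: "(real^2) set \<Rightarrow> real \<times> real \<Rightarrow> bool" where
  "line_coords G = (\<lambda>(p, \<phi>).
     affine G \<and> aff_dim G = 1 \<and> 0 < p \<and> 0 \<le> \<phi> \<and> \<phi> < 2 * pi \<and>
     closest_point G 0 = vector [p * cos \<phi>, p * sin \<phi>])"

definition lines_meeting :: "(real^2) set \<Rightarrow> (real \<times> real) set" where
  "lines_meeting K = {c. \<exists>G. line_coords G c \<and> G \<inter> K \<noteq> {}}"

end

theory Submission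
  imports Defs
begin

text \<open>
  Let \<open>h\<close> be the support function of \<open>K\<close> and let \<open>A(\<theta>)\<close> be the integral of \<open>h(\<phi>) h(\<phi> + \<theta>)\<close> over a
  period, its autocorrelation. A line \<open>(p, \<phi>)\<close> meets \<open>K\<close> exactly when \<open>0 < p \<le> h(\<phi>)\<close>, so
  integrating out \<open>p\<^sub>1\<close> and \<open>p\<^sub>2\<close> turns the right-hand side into the integral of
  \<open>h(\<phi>\<^sub>1) h(\<phi>\<^sub>2) g(\<phi>\<^sub>2 - \<phi>\<^sub>1)\<close>, where \<open>g\<close> is the trigonometric kernel of the statement. Both \<open>A\<close> and
  \<open>g\<close> are even and \<open>2\<pi>\<close>-periodic, so this is \<open>2 \<integral> A g\<close> over \<open>[0, \<pi>]\<close> (\<open>line_pairs_integral\<close>).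

  The left-hand side is reduced to the same integral by sweeping the exterior with half-tangents.
  Orient the boundary curve \<open>\<gamma>\<close> counterclockwise and let \<open>\<nu>(t)\<close> be the angle of the outer normal at
  \<open>\<gamma>(t)\<close>. Up to a null set each exterior point is \<open>\<gamma>(t) + r \<tau>\<close> for exactly one \<open>t\<close> and \<open>r > 0\<close>,
  where \<open>\<tau>\<close> is the unit tangent, and the area element is \<open>r dr d\<nu>\<close>
  (\<open>sweep_change_of_variables\<close>). The point \<open>\<gamma>(t) + r \<tau>\<close> sees \<open>K\<close> under an angle at least \<open>\<pi> - \<theta>\<close>
  exactly when it does not lie beyond the supporting line with normal angle \<open>\<nu> + \<theta>\<close>, that is, when
  \<open>r sin \<theta>\<close> is at most the distance \<open>k\<close> from \<open>\<gamma>(t)\<close> to this line (\<open>visible_iff_tangent_angle\<close>).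
  Hence if \<open>sin\<^sup>m \<omega>\<close> is written as the integral of \<open>- m sin\<^sup>m\<^sup>-\<^sup>1 \<theta> cos \<theta>\<close> over
  \<open>\<pi> - \<omega> \<le> \<theta> \<le> \<pi>\<close>, the integration over \<open>r\<close> can be carried out first; it produces
  \<open>k\<^sup>2 / (2 sin\<^sup>2 \<theta>)\<close>, and the exterior integral equals
  \<open>- (m/2) \<integral> sin\<^sup>m\<^sup>-\<^sup>3 \<theta> cos \<theta> (\<integral> k\<^sup>2 d\<nu>) d\<theta>\<close> (\<open>exterior_integral_eq\<close>).

  Formally \<open>k = h(\<nu> + \<theta>) - h(\<nu>) cos \<theta> - h'(\<nu>) sin \<theta>\<close>. In the expansion of \<open>\<integral> k\<^sup>2 d\<nu>\<close> the squares
  contribute a constant and a multiple of \<open>sin\<^sup>2 \<theta>\<close>, both of which are annihilated by the weight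
  \<open>sin\<^sup>m\<^sup>-\<^sup>3 \<theta> cos \<theta>\<close>; the product \<open>h h'\<close> is exact; the two remaining products are \<open>A(\<theta>)\<close> and
  \<open>- A'(\<theta>)\<close>. One integration by parts in \<open>\<theta>\<close> leaves \<open>\<integral> A g\<close> (\<open>mean_square_gap_integral\<close>).

  The boundary may contain segments, and there \<open>h\<close> is not differentiable as a function of the normal
  angle. Therefore all of this is carried out in the curve parameter \<open>t\<close>: there both \<open>\<nu>\<close> and
  \<open>h \<circ> \<nu>\<close> are continuously differentiable, and the factor \<open>\<nu>'\<close> switches off the flat parts of the
  boundary, whose half-tangents only sweep a null set by Sard's theorem.
\<close>

section \<open>Moving frames and the cross product in the plane\<close>

definition unit_at :: "real \<Rightarrow> real^2" where
  "unit_at a = vector [cos a, sin a]"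

definition tang_at :: "real \<Rightarrow> real^2" where
  "tang_at a = vector [- sin a, cos a]"

definition cross2 :: "real^2 \<Rightarrow> real^2 \<Rightarrow> real" where
  "cross2 x y = x$1 * y$2 - x$2 * y$1"

lemma unit_at_nth [simp]: "unit_at a $ 1 = cos a" "unit_at a $ 2 = sin a"
  by (simp_all add: unit_at_def)

lemma tang_at_nth [simp]: "tang_at a $ 1 = - sin a" "tang_at a $ 2 = cos a"
  by (simp_all add: tang_at_def)

lemma inner_real2: "(x::real^2) \<bullet> y = x$1 * y$1 + x$2 * y$2"
  by (simp add: inner_vec_def sum_2)

lemma vec_eq_real2: "(x::real^2) = y \<longleftrightarrow> x$1 = y$1 \<and> x$2 = y$2"
  by (simp add: vec_eq_iff forall_2)

lemma norm_sq_real2: "(norm (x::real^2))\<^sup>2 = (x$1)\<^sup>2 + (x$2)\<^sup>2"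
  by (metis dot_square_norm inner_real2 power2_eq_square)

lemma norm_unit_at [simp]: "norm (unit_at a) = 1" and norm_tang_at [simp]: "norm (tang_at a) = 1"
  using norm_sq_real2[of "unit_at a"] norm_sq_real2[of "tang_at a"]
  by (simp_all add: power2_eq_1_iff) (smt (verit) norm_ge_zero)+

lemma unit_at_derivative:
  "(unit_at has_vector_derivative tang_at a) (at a within S)"
  "(tang_at has_vector_derivative - unit_at a) (at a within S)"
proof -
  show  "(unit_at has_vector_derivative tang_at a) (at a within S)"
  unfolding has_vector_derivative_def has_derivative_componentwise_within[of unit_at]
  by (auto simp: Basis_vec_def inner_axis forall_2 axis_eq_axis intro!: derivative_eq_intros)
  show "(tang_at has_vector_derivative - unit_at a) (at a within S)"
  unfolding has_vector_derivative_def has_derivative_componentwise_within[of tang_at]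
  by (auto simp: Basis_vec_def inner_axis forall_2 axis_eq_axis intro!: derivative_eq_intros)
qed

section \<open>The support function and the lines that meet a convex set\<close>

definition support_fun :: "(real^2) set \<Rightarrow> real \<Rightarrow> real" where
  "support_fun K a = (SUP x\<in>K. x \<bullet> unit_at a)"

lemma bdd_above_inner: "bounded K \<Longrightarrow> bdd_above ((\<lambda>x. x \<bullet> u) ` (K::(real^2) set))"
  by (intro bounded_imp_bdd_above bounded_linear_image bounded_linear_inner_left)

lemma support_fun_ge:
  assumes "compact K" "x \<in> K" shows "x \<bullet> unit_at a \<le> support_fun K a"
  unfolding support_fun_def using assms by (intro cSUP_upper bdd_above_inner compact_imp_bounded)

lemma support_fun_attained:
  assumes "compact K" "K \<noteq> {}" obtains x where "x \<in> K" "support_fun K a = x \<bullet> unit_at a"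
proof -
  have "continuous_on K (\<lambda>x. x \<bullet> unit_at a)" by (intro continuous_intros)
  then obtain x where x: "x \<in> K" "\<And>y. y \<in> K \<Longrightarrow> y \<bullet> unit_at a \<le> x \<bullet> unit_at a"
    using continuous_attains_sup[OF assms] by metis
  have "support_fun K a = x \<bullet> unit_at a"
    unfolding support_fun_def using x assms by (intro cSup_eq_maximum) auto
  with x that show ?thesis by blast
qed

lemma continuous_on_unit_at: "continuous_on S unit_at" and continuous_on_tang_at: "continuous_on S tang_at"
  by (rule continuous_on_vector_derivative, rule unit_at_derivative)+

lemma continuous_on_support_fun:
  assumes K: "compact K" "K \<noteq> {}" shows "continuous_on S (support_fun K)"
proof -
  obtain D where D: "D > 0" "\<And>x. x \<in> K \<Longrightarrow> norm x \<le> D"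
    using compact_imp_bounded[OF K(1)] unfolding bounded_pos by blast
  have le: "support_fun K a - support_fun K b \<le> D * dist (unit_at a) (unit_at b)" for a b
  proof -
    obtain x where x: "x \<in> K" "support_fun K a = x \<bullet> unit_at a" using support_fun_attained[OF K] .
    have "support_fun K a - support_fun K b \<le> x \<bullet> (unit_at a - unit_at b)"
      using support_fun_ge[OF K(1) x(1), of b] x(2) by (simp add: inner_diff_right)
    also have "\<dots> \<le> norm x * norm (unit_at a - unit_at b)" by (rule norm_cauchy_schwarz)
    also have "\<dots> \<le> D * dist (unit_at a) (unit_at b)"
      unfolding dist_norm using D(2)[OF x(1)] by (intro mult_right_mono) auto
    finally show ?thesis .
  qed
  have lip: "dist (support_fun K a) (support_fun K b) \<le> D * dist (unit_at a) (unit_at b)" for a b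
    using le[of a b] le[of b a] by (simp add: dist_real_def dist_commute abs_le_iff)
  show ?thesis
    unfolding continuous_on_iff
  proof (intro ballI allI impI)
    fix a and e :: real assume a: "a \<in> S" "e > 0"
    have "\<exists>d>0. \<forall>b\<in>S. dist b a < d \<longrightarrow> dist (unit_at b) (unit_at a) < e / D"
      using continuous_on_unit_at[of S, unfolded continuous_on_iff, rule_format, OF a(1), of "e / D"]
        divide_pos_pos[OF a(2) D(1)] by blast
    then obtain d where "d > 0" "\<And>b. b \<in> S \<Longrightarrow> dist b a < d \<Longrightarrow> dist (unit_at b) (unit_at a) < e / D"
      by blast
    moreover have "dist (support_fun K b) (support_fun K a) < e" if "dist (unit_at b) (unit_at a) < e / D" for b
      using le_less_trans[OF lip] that D(1) by (simp add: field_simps)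
    ultimately show "\<exists>d>0. \<forall>b\<in>S. dist b a < d \<longrightarrow> dist (support_fun K b) (support_fun K a) < e" by meson
  qed
qed

lemma unit_at_periodic: "unit_at (a + 2 * pi) = unit_at a"
  unfolding vec_eq_real2 unit_at_nth sin_periodic cos_periodic by blast

lemma support_fun_periodic: "support_fun K (a + 2 * pi) = support_fun K a"
  unfolding support_fun_def unit_at_periodic ..

lemma support_fun_pos:
  assumes "compact K" "0 \<in> interior K" shows "support_fun K a > 0"
proof -
  obtain e where "e > 0" "cball 0 e \<subseteq> K" using assms(2) mem_interior_cball by blast
  then have "e *\<^sub>R unit_at a \<in> K" by auto
  from support_fun_ge[OF assms(1) this, of a] \<open>e > 0\<close> show ?thesis
    by (simp add: dot_square_norm)
qed

text \<open>The foot of the perpendicular from the origin to a line is its closest point, so a line with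
  coordinates \<open>(p, a)\<close> is the level set \<open>{y. y \<bullet> unit_at a = p}\<close>. It meets \<open>K\<close> as soon as
  \<open>p \<le> support_fun K a\<close>, because \<open>K\<close> contains the segment from the origin to a point at which
  the support function is attained.\<close>

lemma lines_meeting_eq:
  assumes K: "compact K" "convex K" "0 \<in> interior K"
  shows "lines_meeting K = {(p, a). 0 < p \<and> p \<le> support_fun K a \<and> 0 \<le> a \<and> a < 2 * pi}"
proof (intro set_eqI iffI)
  have K0: "0 \<in> K" using K(3) interior_subset by blast
  have vec: "vector [p * cos a, p * sin a] = p *\<^sub>R unit_at a" for p a
    by (simp add: vec_eq_real2)
  {
    fix c assume "c \<in> lines_meeting K"
    then obtain G p a x where c: "c = (p, a)" and G: "affine G" "0 < p" "0 \<le> a" "a < 2 * pi"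
      "closest_point G 0 = p *\<^sub>R unit_at a" and x: "x \<in> G" "x \<in> K"
      unfolding lines_meeting_def line_coords_def vec by blast
    have clo: "closed G" "convex G" using G(1) by (auto simp: affine_closed affine_imp_convex)
    have "(0 - closest_point G 0) \<bullet> (x - closest_point G 0) \<le> 0"
      by (rule closest_point_dot) (use clo x in auto)
    then have "0 \<le> p * (x \<bullet> unit_at a - p)"
      by (simp add: G(5) inner_diff_right dot_square_norm inner_commute algebra_simps power2_eq_square)
    then have "p \<le> x \<bullet> unit_at a" using G(2) by (simp add: zero_le_mult_iff)
    also have "\<dots> \<le> support_fun K a" using support_fun_ge[OF K(1) x(2)] .
    finally show "c \<in> {(p, a). 0 < p \<and> p \<le> support_fun K a \<and> 0 \<le> a \<and> a < 2 * pi}" using G c by auto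
  next
    fix c assume "c \<in> {(p, a). 0 < p \<and> p \<le> support_fun K a \<and> 0 \<le> a \<and> a < 2 * pi}"
    then obtain p a where c: "c = (p, a)" "0 < p" "p \<le> support_fun K a" "0 \<le> a" "a < 2 * pi" by auto
    define G where "G = {y. unit_at a \<bullet> y = p}"
    have "unit_at a \<noteq> 0" using norm_unit_at[of a] by (metis norm_zero zero_neq_one)
    then have "aff_dim G = 1" unfolding G_def by (simp add: aff_dim_hyperplane)
    moreover have "affine G" unfolding G_def by (rule affine_hyperplane)
    moreover have "p *\<^sub>R unit_at a = closest_point G 0"
    proof (rule closest_point_unique)
      show "convex G" "closed G" using \<open>affine G\<close> by (auto simp: affine_closed affine_imp_convex)
      show "p *\<^sub>R unit_at a \<in> G" by (simp add: G_def dot_square_norm)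
      show "\<forall>z\<in>G. dist 0 (p *\<^sub>R unit_at a) \<le> dist 0 z"
      proof
        fix z assume "z \<in> G"
        then show "dist 0 (p *\<^sub>R unit_at a) \<le> dist 0 z"
          using norm_cauchy_schwarz[of "unit_at a" z] c(2) by (simp add: G_def)
      qed
    qed
    ultimately have "line_coords G (p, a)" using c by (simp add: line_coords_def vec)
    moreover have "G \<inter> K \<noteq> {}"
    proof -
      obtain x where x: "x \<in> K" "support_fun K a = x \<bullet> unit_at a" using support_fun_attained[OF K(1)] K0 by blast
      let ?s = "p / support_fun K a"
      have "?s *\<^sub>R x + (1 - ?s) *\<^sub>R 0 \<in> K"
        using K(2) x(1) K0 c by (intro convexD) (auto simp: field_simps)
      moreover have "?s *\<^sub>R x \<in> G" using c x(2) by (simp add: G_def inner_commute)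
      ultimately show ?thesis by auto
    qed
    ultimately show "c \<in> lines_meeting K" using c(1) by (auto simp: lines_meeting_def)
  }
qed

section \<open>Pairs of tangents and the visual angle\<close>

text \<open>\<open>A\<close> and \<open>B\<close> are points of contact of the two tangents from \<open>P\<close>, seen from \<open>P\<close> in
  counterclockwise order. Expressing the sector by the signs of two cross products makes the
  condition closed in \<open>A\<close>, \<open>B\<close> and \<open>P\<close> jointly.\<close>

definition tangent_pair :: "(real^2) set \<Rightarrow> real^2 \<Rightarrow> real^2 \<Rightarrow> real^2 \<Rightarrow> bool" where
  "tangent_pair K P A B \<longleftrightarrow> A \<in> K \<and> B \<in> K \<and>
     (\<forall>x\<in>K. 0 \<le> cross2 (A - P) (x - P) \<and> 0 \<le> cross2 (x - P) (B - P))"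

text \<open>For two vectors \<open>a\<close>, \<open>x\<close> on the positive side of \<open>e\<close>, this compares their slopes
  \<open>cross2 e a / (e \<bullet> a)\<close> and \<open>cross2 e x / (e \<bullet> x)\<close> with respect to \<open>e\<close>.\<close>

lemma cross2_pencil: "(e \<bullet> e) * cross2 a x = (e \<bullet> a) * cross2 e x - (e \<bullet> x) * cross2 e a"
  unfolding cross2_def inner_real2 by algebra

text \<open>Cramer's rule.\<close>

lemma cross2_expand: "cross2 a b *\<^sub>R w = cross2 w b *\<^sub>R a + cross2 a w *\<^sub>R b"
  unfolding cross2_def vec_eq_real2 by (simp add: algebra_simps)

text \<open>A line separating \<open>P\<close> from \<open>K\<close> provides a direction \<open>e\<close> in which \<open>K\<close> lies strictly ahead of
  \<open>P\<close>; points of contact are those where the slope of \<open>x - P\<close> with respect to \<open>e\<close> is extremal.\<close>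

lemma tangent_pair_exists:
  assumes K: "compact K" "convex K" "K \<noteq> {}" and P: "P \<notin> K"
  obtains A B where "tangent_pair K P A B"
proof -
  obtain e b where e: "e \<bullet> P < b" "\<And>x. x \<in> K \<Longrightarrow> b < e \<bullet> x"
    using separating_hyperplane_closed_point[OF K(2) compact_imp_closed[OF K(1)] P] by metis
  have pos: "0 < e \<bullet> (x - P)" if "x \<in> K" for x
    using e(1) e(2)[OF that] by (simp add: inner_diff_right)
  define f where "f x = cross2 e (x - P) / (e \<bullet> (x - P))" for x
  have cont: "continuous_on K f"
    unfolding f_def cross2_def using pos by (intro continuous_intros) force
  obtain A where A: "A \<in> K" "\<And>x. x \<in> K \<Longrightarrow> f A \<le> f x"
    using continuous_attains_inf[OF K(1,3) cont] by metis
  obtain B where B: "B \<in> K" "\<And>x. x \<in> K \<Longrightarrow> f x \<le> f B"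
    using continuous_attains_sup[OF K(1,3) cont] by metis
  have "e \<noteq> 0" using pos K(3) by force
  then have ee: "0 < e \<bullet> e" by simp
  have ord: "0 \<le> cross2 (y - P) (x - P)" if "x \<in> K" "y \<in> K" "f y \<le> f x" for x y
  proof -
    have "cross2 e (y - P) * (e \<bullet> (x - P)) \<le> cross2 e (x - P) * (e \<bullet> (y - P))"
      using that(3) pos[OF that(1)] pos[OF that(2)] by (simp add: f_def field_simps)
    then have "0 \<le> (e \<bullet> e) * cross2 (y - P) (x - P)"
      unfolding cross2_pencil by (simp add: mult.commute)
    then show ?thesis using ee mult_pos_neg[OF ee] by (meson not_le)
  qed
  have "tangent_pair K P A B" unfolding tangent_pair_def using A B ord by blast
  with that show ?thesis .
qed

lemma push_in_interior:
  fixes z v :: "real^2"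
  assumes "z \<in> interior K" obtains e where "e > 0" "z + e *\<^sub>R v \<in> K"
proof -
  obtain d where d: "d > 0" "cball z d \<subseteq> K" using assms mem_interior_cball by blast
  have "norm ((d / (1 + norm v)) *\<^sub>R v) \<le> d"
    using d(1) mult_left_mono[of "norm v" "1 + norm v" d] by (simp add: pos_divide_le_eq add_pos_nonneg)
  then have "z + (d / (1 + norm v)) *\<^sub>R v \<in> K" using d(2) by (auto simp: dist_norm)
  moreover have "d / (1 + norm v) > 0" using d(1) by (simp add: add_pos_nonneg)
  ultimately show ?thesis using that by blast
qed

text \<open>Moving from an interior point into the forbidden side of the line through \<open>P\<close> in direction \<open>a\<close>
  would violate the sign condition.\<close>

lemma cross2_supporting_not_interior:
  assumes "\<And>x. x \<in> K \<Longrightarrow> 0 \<le> cross2 a (x - P)" "cross2 a (A - P) = 0" "a \<noteq> 0"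
  shows "A \<notin> interior K"
proof
  assume "A \<in> interior K"
  then obtain e where e: "e > 0" "A + e *\<^sub>R vector [a$2, - a$1] \<in> K" by (rule push_in_interior)
  have "cross2 a (A + e *\<^sub>R vector [a$2, - a$1] - P) = cross2 a (A - P) - e * ((a$1)\<^sup>2 + (a$2)\<^sup>2)"
    by (simp add: cross2_def power2_eq_square algebra_simps)
  then have "e * ((a$1)\<^sup>2 + (a$2)\<^sup>2) \<le> 0" using assms(1)[OF e(2)] assms(2) by simp
  moreover have "(a$1)\<^sup>2 + (a$2)\<^sup>2 > 0" using assms(3) norm_sq_real2[of a] by (metis zero_less_norm_iff zero_less_power)
  ultimately show False using e(1) by (simp add: mult_le_0_iff)
qed

lemma cross2_flip: "cross2 (- b) x = cross2 x b" and cross2_self [simp]: "cross2 a a = 0"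
  by (simp_all add: cross2_def)

locale exterior_point =
  fixes K :: "(real^2) set" and P :: "real^2"
  assumes K: "compact K" "convex K" "interior K \<noteq> {}" and P: "P \<notin> K"
begin

text \<open>If the two tangent directions were parallel, they would either agree, and then \<open>K\<close> would lie on a
  line, or be opposite, and then \<open>P\<close> would lie on the segment from \<open>A\<close> to \<open>B\<close>.\<close>

lemma tangent_pair_pos:
  assumes "tangent_pair K P A B"
  shows "0 < cross2 (A - P) (B - P)"
proof (rule ccontr)
  define a b where "a = A - P" and "b = B - P"
  have AB: "A \<in> K" "B \<in> K" and cr: "\<And>x. x \<in> K \<Longrightarrow> 0 \<le> cross2 a (x - P)" "\<And>x. x \<in> K \<Longrightarrow> 0 \<le> cross2 (x - P) b"
    using assms by (auto simp: tangent_pair_def a_def b_def)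
  have nz: "a \<noteq> 0" "b \<noteq> 0" using AB P by (auto simp: a_def b_def)
  assume "\<not> 0 < cross2 (A - P) (B - P)"
  with cr(1)[OF AB(2)] have 0: "cross2 a b = 0" by (simp add: a_def b_def)
  have par: "(a \<bullet> a) *\<^sub>R b = (a \<bullet> b) *\<^sub>R a"
  proof -
    have "(a \<bullet> a) * b$1 = (a \<bullet> b) * a$1 - cross2 a b * a$2" "(a \<bullet> a) * b$2 = (a \<bullet> b) * a$2 + cross2 a b * a$1"
      unfolding cross2_def inner_real2 by algebra+
    then show ?thesis by (simp add: 0 vec_eq_real2)
  qed
  have aa: "0 < a \<bullet> a" using nz by simp
  define c where "c = (a \<bullet> b) / (a \<bullet> a)"
  have b: "b = c *\<^sub>R a"
    using arg_cong[OF par, of "\<lambda>v. (1 / (a \<bullet> a)) *\<^sub>R v"] aa by (simp add: c_def)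
  show False
  proof (cases "c > 0")
    case True
    have "cross2 a (x - P) = 0" if "x \<in> K" for x
    proof -
      have "cross2 (x - P) b = - c * cross2 a (x - P)" by (simp add: b cross2_def algebra_simps)
      with cr[OF that] True show ?thesis by (smt (verit) mult_minus_left mult_pos_pos)
    qed
    moreover obtain z where z: "z \<in> interior K" using K(3) by blast
    ultimately show False
      using cross2_supporting_not_interior[of K a P z] nz interior_subset by fastforce
  next
    case False
    with nz b have c: "c < 0" by (metis linorder_neqE_linordered_idom scaleR_zero_left)
    have "P = (- c / (1 - c)) *\<^sub>R A + (1 / (1 - c)) *\<^sub>R B"
    proof -
      have "B - P = c *\<^sub>R (A - P)" using b by (simp add: a_def b_def)
      then have "(1 - c) *\<^sub>R P = (- c) *\<^sub>R A + B" by (simp add: algebra_simps)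
      then have "(1 / (1 - c)) *\<^sub>R ((1 - c) *\<^sub>R P) = (1 / (1 - c)) *\<^sub>R ((- c) *\<^sub>R A + B)" by simp
      then show ?thesis using c by (simp add: scaleR_diff_right)
    qed
    moreover have "(- c / (1 - c)) *\<^sub>R A + (1 / (1 - c)) *\<^sub>R B \<in> K"
      using c by (intro convexD[OF K(2)] AB) (auto simp: field_simps)
    ultimately show False using P by simp
  qed
qed

lemma tangent_pair_coordinates:
  assumes "tangent_pair K P A B" "x \<in> K"
  obtains s t where "0 \<le> s" "0 \<le> t" "x - P = s *\<^sub>R (A - P) + t *\<^sub>R (B - P)"
proof -
  let ?d = "cross2 (A - P) (B - P)"
  have d: "0 < ?d" using tangent_pair_pos[OF assms(1)] .
  have "x - P = (1 / ?d) *\<^sub>R (?d *\<^sub>R (x - P))" using d by simp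
  also have "\<dots> = (cross2 (x - P) (B - P) / ?d) *\<^sub>R (A - P) + (cross2 (A - P) (x - P) / ?d) *\<^sub>R (B - P)"
    unfolding cross2_expand[of "A - P" "B - P" "x - P"] by (simp add: scaleR_add_right)
  finally show ?thesis
    using that[of "cross2 (x - P) (B - P) / ?d" "cross2 (A - P) (x - P) / ?d"] assms d
    by (auto simp: tangent_pair_def)
qed

lemma tangent_pair_sector:
  assumes "tangent_pair K P A B" shows "K \<subseteq> sector P (A - P) (B - P)"
proof
  fix x assume "x \<in> K"
  then obtain s t where "0 \<le> s" "0 \<le> t" "x - P = s *\<^sub>R (A - P) + t *\<^sub>R (B - P)"
    using tangent_pair_coordinates[OF assms] by blast
  moreover from this(3) have "x = P + s *\<^sub>R (A - P) + t *\<^sub>R (B - P)"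
    by (metis add.assoc add.commute diff_add_cancel)
  ultimately show "x \<in> sector P (A - P) (B - P)"
    unfolding sector_def by blast
qed

lemma tangent_pair_frontier:
  assumes "tangent_pair K P A B" shows "A \<in> frontier K" "B \<in> frontier K"
proof -
  have AB: "A \<in> K" "B \<in> K" and cr: "\<And>x. x \<in> K \<Longrightarrow> 0 \<le> cross2 (A - P) (x - P)" "\<And>x. x \<in> K \<Longrightarrow> 0 \<le> cross2 (- (B - P)) (x - P)"
    using assms unfolding tangent_pair_def cross2_flip by blast+
  have nz: "A - P \<noteq> 0" "- (B - P) \<noteq> 0" using AB P by auto
  have "A \<notin> interior K" using cross2_supporting_not_interior[OF cr(1) _ nz(1)] by simp
  moreover have "B \<notin> interior K" using cross2_supporting_not_interior[OF cr(2) _ nz(2)] unfolding cross2_flip by simp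
  ultimately show "A \<in> frontier K" "B \<in> frontier K"
    using AB closure_subset by (auto simp: frontier_def)
qed

end

lemma vec_angle_commute: "vec_angle u v = vec_angle v u"
  by (simp add: vec_angle_def inner_commute mult.commute)

lemma vec_angle_scale: "c > 0 \<Longrightarrow> d > 0 \<Longrightarrow> vec_angle (c *\<^sub>R u) (d *\<^sub>R v) = vec_angle u v"
  by (simp add: vec_angle_def)

text \<open>The two changes of generators are nonnegative matrices inverse to each other, hence monomial: the
  extreme rays of the cone agree up to order.\<close>

lemma cone_generators_unique:
  fixes a b a' b' :: "real^2"
  assumes ab: "cross2 a b \<noteq> 0"
    and a: "a = s *\<^sub>R a' + t *\<^sub>R b'" and b: "b = s' *\<^sub>R a' + t' *\<^sub>R b'"
    and a': "a' = p *\<^sub>R a + q *\<^sub>R b" and b': "b' = p' *\<^sub>R a + q' *\<^sub>R b"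
    and nn: "0 \<le> s" "0 \<le> t" "0 \<le> s'" "0 \<le> t'" "0 \<le> p" "0 \<le> q" "0 \<le> p'" "0 \<le> q'"
  shows "vec_angle a b = vec_angle a' b'"
proof -
  have indep: "x = x' \<and> y = y'" if "x *\<^sub>R a + y *\<^sub>R b = x' *\<^sub>R a + y' *\<^sub>R b" for x y x' y'
  proof -
    have "cross2 (x *\<^sub>R a + y *\<^sub>R b) b = x * cross2 a b" "cross2 a (x *\<^sub>R a + y *\<^sub>R b) = y * cross2 a b" for x y
      by (simp_all add: cross2_def algebra_simps)
    from this(1)[of x y] this(1)[of x' y'] this(2)[of x y] this(2)[of x' y'] that ab
    show ?thesis by simp
  qed
  have "1 *\<^sub>R a + 0 *\<^sub>R b = (s * p + t * p') *\<^sub>R a + (s * q + t * q') *\<^sub>R b"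
    using a unfolding a' b' by (simp add: algebra_simps)
  from indep[OF this] have 1: "s * p + t * p' = 1" "s * q + t * q' = 0" by auto
  have "0 *\<^sub>R a + 1 *\<^sub>R b = (s' * p + t' * p') *\<^sub>R a + (s' * q + t' * q') *\<^sub>R b"
    using b unfolding a' b' by (simp add: algebra_simps)
  from indep[OF this] have 2: "s' * p + t' * p' = 0" "s' * q + t' * q' = 1" by auto
  have z: "s * q = 0" "t * q' = 0" "s' * p = 0" "t' * p' = 0"
    using 1(2) 2(1) nn by (simp_all add: add_nonneg_eq_0_iff)
  show ?thesis
  proof (cases "s = 0")
    case True
    with 1 z have "t > 0" "q' = 0" "p' > 0" using nn by (auto simp: less_le)
    with z 2 have "t' = 0" "s' > 0" using nn by (auto simp: less_le)
    have "vec_angle a b = vec_angle b' a'"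
      using vec_angle_scale[OF \<open>t > 0\<close> \<open>s' > 0\<close>] unfolding a[unfolded True] b[unfolded \<open>t' = 0\<close>] by simp
    then show ?thesis by (simp add: vec_angle_commute)
  next
    case False
    with z have "q = 0" "s > 0" using nn by auto
    with 2 z have "t' > 0" "q' > 0" "t = 0" using nn by (auto simp: less_le)
    with z 2 have "p' = 0" by auto
    with 1 have "p \<noteq> 0" by auto
    with z have "s' = 0" by auto
    show ?thesis
      using vec_angle_scale[OF \<open>s > 0\<close> \<open>t' > 0\<close>] unfolding a[unfolded \<open>t = 0\<close>] b[unfolded \<open>s' = 0\<close>] by simp
  qed
qed

context exterior_point
begin

text \<open>Two pairs of contact points generate the same cone at \<open>P\<close>, so the definite description in
  the definition of the visual angle is satisfied by a single number.\<close>

lemma visual_angle_eq: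
  assumes "tangent_pair K P A B"
  shows "visual_angle K P = vec_angle (A - P) (B - P)"
  unfolding visual_angle_def
proof (rule the_equality)
  show "\<exists>A'\<in>frontier K. \<exists>B'\<in>frontier K. K \<subseteq> sector P (A' - P) (B' - P) \<and>
      vec_angle (A - P) (B - P) = vec_angle (A' - P) (B' - P)"
    using tangent_pair_frontier[OF assms] tangent_pair_sector[OF assms] by blast
next
  fix w assume "\<exists>A'\<in>frontier K. \<exists>B'\<in>frontier K. K \<subseteq> sector P (A' - P) (B' - P) \<and> w = vec_angle (A' - P) (B' - P)"
  then obtain A' B' where A': "A' \<in> frontier K" "B' \<in> frontier K" "K \<subseteq> sector P (A' - P) (B' - P)"
    and w: "w = vec_angle (A' - P) (B' - P)" by blast
  have fr: "frontier K \<subseteq> K" using K(1) by (simp add: compact_imp_closed frontier_subset_closed)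
  have AB: "A \<in> K" "B \<in> K" using assms by (auto simp: tangent_pair_def)
  have sec: "\<exists>s t. 0 \<le> s \<and> 0 \<le> t \<and> x - P = s *\<^sub>R (A' - P) + t *\<^sub>R (B' - P)" if x: "x \<in> K" for x
  proof -
    obtain s t where "x = P + s *\<^sub>R (A' - P) + t *\<^sub>R (B' - P)" "0 \<le> s" "0 \<le> t"
      using A'(3) x unfolding sector_def by blast
    moreover from this(1) have "x - P = s *\<^sub>R (A' - P) + t *\<^sub>R (B' - P)"
      by (simp only: add.assoc add_diff_cancel_left')
    ultimately show ?thesis by blast
  qed
  obtain s t where st: "0 \<le> s" "0 \<le> t" "A - P = s *\<^sub>R (A' - P) + t *\<^sub>R (B' - P)" using sec[OF AB(1)] by blast
  obtain s' t' where st': "0 \<le> s'" "0 \<le> t'" "B - P = s' *\<^sub>R (A' - P) + t' *\<^sub>R (B' - P)" using sec[OF AB(2)] by blast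
  obtain p q where pq: "0 \<le> p" "0 \<le> q" "A' - P = p *\<^sub>R (A - P) + q *\<^sub>R (B - P)"
    using tangent_pair_coordinates[OF assms] A'(1) fr by blast
  obtain p' q' where pq': "0 \<le> p'" "0 \<le> q'" "B' - P = p' *\<^sub>R (A - P) + q' *\<^sub>R (B - P)"
    using tangent_pair_coordinates[OF assms] A'(2) fr by blast
  have "cross2 (A - P) (B - P) \<noteq> 0" using tangent_pair_pos[OF assms] by simp
  from cone_generators_unique[OF this st(3) st'(3) pq(3) pq'(3) st(1,2) st'(1,2) pq(1,2) pq'(1,2)]
  show "w = vec_angle (A - P) (B - P)" unfolding w by (rule sym)
qed

end

lemma abs_cosine_le_1: "\<bar>(a \<bullet> b) / (norm a * norm b)\<bar> \<le> (1::real)"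
proof -
  have "\<bar>x / y\<bar> \<le> 1" if "\<bar>x\<bar> \<le> y" for x y :: real
    using that by (cases "y = 0") (auto simp: divide_le_eq_1)
  then show ?thesis using Cauchy_Schwarz_ineq2[of a b] .
qed

context exterior_point
begin

lemma tangent_pair_nonzero:
  assumes "tangent_pair K P A B" shows "A - P \<noteq> 0" "B - P \<noteq> 0"
  using assms P by (auto simp: tangent_pair_def)

lemma cos_visual_angle:
  assumes "tangent_pair K P A B"
  shows "cos (visual_angle K P) = ((A - P) \<bullet> (B - P)) / (norm (A - P) * norm (B - P))"
proof -
  have "\<bar>((A - P) \<bullet> (B - P)) / (norm (A - P) * norm (B - P))\<bar> \<le> 1"
    by (rule abs_cosine_le_1)
  then show ?thesis
    unfolding visual_angle_eq[OF assms] vec_angle_def by (intro cos_arccos) linarith+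
qed

lemma visual_angle_range: "0 \<le> visual_angle K P" "visual_angle K P \<le> pi"
proof -
  obtain A B where AB: "tangent_pair K P A B"
    using tangent_pair_exists[OF K(1,2) _ P] K(3) interior_empty by blast
  have "\<bar>((A - P) \<bullet> (B - P)) / (norm (A - P) * norm (B - P))\<bar> \<le> 1" (is "\<bar>?c\<bar> \<le> 1")
    by (rule abs_cosine_le_1)
  then have "0 \<le> arccos ?c" "arccos ?c \<le> pi" by (intro arccos_lbound arccos_ubound; linarith)+
  then show "0 \<le> visual_angle K P" "visual_angle K P \<le> pi"
    unfolding visual_angle_eq[OF AB] vec_angle_def by blast+
qed

text \<open>The existential form presents the sublevel sets of the cosine as projections of closed sets along
  the compact set \<open>K \<times> K\<close>; this is how measurability is obtained below.\<close>

lemma cos_visual_angle_le_iff: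
  "cos (visual_angle K P) \<le> c \<longleftrightarrow>
     (\<exists>A B. tangent_pair K P A B \<and> (A - P) \<bullet> (B - P) \<le> c * (norm (A - P) * norm (B - P)))"
  (is "?L \<longleftrightarrow> ?R")
proof -
  have iff: "?L \<longleftrightarrow> (A - P) \<bullet> (B - P) \<le> c * (norm (A - P) * norm (B - P))" if "tangent_pair K P A B" for A B
    unfolding cos_visual_angle[OF that] using tangent_pair_nonzero[OF that] by (simp add: divide_le_eq)
  obtain A B where "tangent_pair K P A B"
    using tangent_pair_exists[OF K(1,2) _ P] K(3) interior_empty by blast
  with iff show ?thesis by blast
qed

text \<open>\<open>P\<close> lies on the half-tangent at \<open>X\<close> with normal angle \<open>n\<close>, so one side of the visual angle
  points back along \<open>- tang_at n\<close>, and the other side is obtained from it by a clockwise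
  rotation through the visual angle \<open>w\<close>. In the direction \<open>n + th\<close> the first side always
  descends, while the second has slope \<open>- sin (w + th)\<close>. So \<open>K\<close> reaches beyond \<open>P\<close> in this
  direction exactly when \<open>w + th \<ge> pi\<close>.\<close>

lemma visible_iff_tangent_angle:
  assumes pt: "P = X + r *\<^sub>R tang_at n" and X: "X \<in> K" and r: "0 < r"
    and sup: "\<And>x. x \<in> K \<Longrightarrow> (x - X) \<bullet> unit_at n \<le> 0"
    and th: "0 < th" "th < pi"
  shows "P \<bullet> unit_at (n + th) \<le> support_fun K (n + th) \<longleftrightarrow> pi - visual_angle K P \<le> th"
proof -
  define w where "w = visual_angle K P"
  define u where "u = unit_at (n + th)"
  obtain A B' where "tangent_pair K P A B'"
    using tangent_pair_exists[OF K(1,2) _ P] K(3) interior_empty by blast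
  moreover have tn: "cross2 v (tang_at n) = v \<bullet> unit_at n" for v
    by (simp add: cross2_def inner_real2)
  have "cross2 (x - P) (X - P) = - r * ((x - X) \<bullet> unit_at n)" for x
    unfolding tn[symmetric] pt by (simp add: cross2_def algebra_simps)
  ultimately have AX: "tangent_pair K P A X"
    unfolding tangent_pair_def using X r sup by (simp add: mult_le_0_iff)
  define a where "a = A - P"
  have XP: "X - P = (- r) *\<^sub>R tang_at n" by (simp add: pt)
  have a0: "a \<noteq> 0" using tangent_pair_nonzero[OF AX] by (simp add: a_def)
  have cosw: "cos w = - (a \<bullet> tang_at n) / norm a"
    unfolding w_def cos_visual_angle[OF AX] XP using r by (simp add: a_def)
  have "0 < cross2 a (X - P)" using tangent_pair_pos[OF AX] by (simp add: a_def)
  also have "cross2 a (X - P) = - r * (a \<bullet> unit_at n)"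
    unfolding XP tn[symmetric] by (simp add: cross2_def algebra_simps)
  finally have neg: "a \<bullet> unit_at n < 0" using r by (simp add: zero_less_mult_iff mult_less_0_iff)
  have pyth: "(a \<bullet> tang_at n)\<^sup>2 + (a \<bullet> unit_at n)\<^sup>2 = (norm a)\<^sup>2"
  proof -
    have "(a \<bullet> tang_at n)\<^sup>2 + (a \<bullet> unit_at n)\<^sup>2 = ((a$1)\<^sup>2 + (a$2)\<^sup>2) * ((sin n)\<^sup>2 + (cos n)\<^sup>2)"
      unfolding inner_real2 tang_at_nth unit_at_nth by algebra
    then show ?thesis by (simp add: norm_sq_real2)
  qed
  have "(sin w)\<^sup>2 = (- (a \<bullet> unit_at n) / norm a)\<^sup>2"
    using pyth a0 by (simp add: sin_squared_eq cosw power_divide field_simps)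
  moreover have "0 \<le> sin w" using visual_angle_range unfolding w_def by (rule sin_ge_zero)
  moreover have "0 \<le> - (a \<bullet> unit_at n) / norm a" using neg by (intro divide_nonneg_nonneg) auto
  ultimately have sinw: "sin w = - (a \<bullet> unit_at n) / norm a" by (meson power2_eq_imp_eq)
  \<comment> \<open>\<open>a\<close> has frame coordinates \<open>- norm a * cos w\<close> along the tangent and \<open>- norm a * sin w\<close> along the normal\<close>
  have au: "a \<bullet> u = - norm a * sin (w + th)"
  proof -
    have "a \<bullet> u = cos th * (a \<bullet> unit_at n) + sin th * (a \<bullet> tang_at n)"
      unfolding u_def inner_real2 tang_at_nth unit_at_nth cos_add sin_add by algebra
    also have "a \<bullet> unit_at n = - norm a * sin w" using sinw a0 by simp
    also have "a \<bullet> tang_at n = - norm a * cos w" using cosw a0 by simp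
    finally show ?thesis by (simp add: sin_add algebra_simps)
  qed
  have w: "0 < w" "w < pi"
  proof -
    have "0 < - (a \<bullet> unit_at n) / norm a" using neg a0 by (intro divide_pos_pos) auto
    then have "0 < sin w" unfolding sinw .
    then show "0 < w" "w < pi" using visual_angle_range unfolding w_def by (auto simp: less_le)
  qed
  show ?thesis
  proof
    assume "pi - visual_angle K P \<le> th"
    then have "0 \<le> sin (w + th - pi)" using w th by (intro sin_ge_zero) (auto simp: w_def)
    then have "0 \<le> a \<bullet> u" unfolding au using a0 by (simp add: sin_diff mult_le_0_iff)
    then have "P \<bullet> u \<le> A \<bullet> u" by (simp add: a_def inner_diff_left)
    also have "\<dots> \<le> support_fun K (n + th)" unfolding u_def using AX by (intro support_fun_ge K) (simp add: tangent_pair_def)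
    finally show "P \<bullet> unit_at (n + th) \<le> support_fun K (n + th)" by (simp add: u_def)
  next
    assume le: "P \<bullet> unit_at (n + th) \<le> support_fun K (n + th)"
    obtain x where x: "x \<in> K" "support_fun K (n + th) = x \<bullet> u"
      using support_fun_attained[OF K(1)] K(3) interior_empty unfolding u_def by metis
    obtain s t where st: "0 \<le> s" "0 \<le> t" "x - P = s *\<^sub>R a + t *\<^sub>R (X - P)"
      using tangent_pair_coordinates[OF AX x(1)] unfolding a_def .
    show "pi - visual_angle K P \<le> th"
    proof (rule ccontr)
      assume "\<not> ?thesis"
      then have "0 < sin (w + th)" using w th by (intro sin_gt_zero) (auto simp: w_def)
      then have "a \<bullet> u < 0" unfolding au using a0 by (simp add: mult_pos_pos)
      moreover have "(X - P) \<bullet> u < 0"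
      proof -
        have "tang_at n \<bullet> u = sin th * ((sin n)\<^sup>2 + (cos n)\<^sup>2)"
          unfolding u_def inner_real2 tang_at_nth unit_at_nth cos_add sin_add by algebra
        then show ?thesis unfolding XP using r th by (simp add: sin_gt_zero)
      qed
      moreover have "s \<noteq> 0 \<or> t \<noteq> 0" using st(3) x(1) P by auto
      ultimately have "s * (a \<bullet> u) + t * ((X - P) \<bullet> u) < 0"
        using st(1,2) by (smt (verit) mult_pos_neg mult_nonneg_nonpos)
      then have "(x - P) \<bullet> u < 0" by (simp add: st(3) inner_add_left)
      with le x(2) show False by (simp add: u_def inner_diff_left)
    qed
  qed
qed

end

lemma closed_tangent_pairs:
  fixes K :: "(real^2) set"
  assumes K: "compact K"
  shows "closedin (top_of_set ((K \<times> K) \<times> (- K)))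
    {((A, B), P). P \<notin> K \<and> tangent_pair K P A B \<and> (A - P) \<bullet> (B - P) \<le> c * (norm (A - P) * norm (B - P))}"
    (is "closedin _ ?U")
proof -
  let ?V = "(\<Inter>x\<in>K. {z. 0 \<le> cross2 (fst (fst z) - snd z) (x - snd z)} \<inter> {z. 0 \<le> cross2 (x - snd z) (snd (fst z) - snd z)})
    \<inter> {z. (fst (fst z) - snd z) \<bullet> (snd (fst z) - snd z) \<le> c * (norm (fst (fst z) - snd z) * norm (snd (fst z) - snd z))}"
  have "closed ?V"
    unfolding cross2_def by (intro closed_Int closed_INT ballI closed_Collect_le continuous_intros)
  moreover have "?U = ((K \<times> K) \<times> (- K)) \<inter> ?V" by (auto simp: tangent_pair_def)
  ultimately show ?thesis by (simp only: closedin_closed_Int)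
qed

lemma sin_visual_angle_measurable:
  assumes K: "compact K" "convex K" "interior K \<noteq> {}"
  shows "set_borel_measurable borel (- K) (\<lambda>P. sin (visual_angle K P) ^ m)"
proof -
  have ext: "exterior_point K P" if "P \<notin> K" for P using K that by unfold_locales
  let ?R = "restrict_space borel (- K)"
  have op: "open (- K)" using K(1) by (simp add: compact_imp_closed open_Compl)
  have sp: "space ?R = - K" by (simp add: space_restrict_space)
  have "(\<lambda>P. cos (visual_angle K P)) \<in> borel_measurable ?R"
    unfolding borel_measurable_iff_le sp
  proof
    fix c
    let ?S = "{P \<in> - K. cos (visual_angle K P) \<le> c}"
    have tp: "A \<in> K" "B \<in> K" if "tangent_pair K P A B" for P A B
      using that by (auto simp: tangent_pair_def)
    have "?S = {P. P \<notin> K \<and> (\<exists>A B. tangent_pair K P A B \<and> (A - P) \<bullet> (B - P) \<le> c * (norm (A - P) * norm (B - P)))}"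
      using exterior_point.cos_visual_angle_le_iff[OF ext] by auto
    also have "\<dots> = {P. \<exists>AB. AB \<in> K \<times> K \<and> (AB, P) \<in> {((A, B), P). P \<notin> K \<and> tangent_pair K P A B \<and>
        (A - P) \<bullet> (B - P) \<le> c * (norm (A - P) * norm (B - P))}}"
      by (auto dest: tp)
    finally have S: "?S = {P. \<exists>AB. AB \<in> K \<times> K \<and> (AB, P) \<in> {((A, B), P). P \<notin> K \<and> tangent_pair K P A B \<and>
        (A - P) \<bullet> (B - P) \<le> c * (norm (A - P) * norm (B - P))}}" .
    have "closedin (top_of_set (- K)) ?S"
      unfolding S by (rule closedin_compact_projection[OF compact_Times[OF K(1) K(1)] closed_tangent_pairs[OF K(1), of c]])
    then obtain T where "closed T" "?S = - K \<inter> T" by (auto simp: closedin_closed)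
    then show "?S \<in> sets ?R" using op by (auto simp: sets_restrict_space)
  qed
  then have "(\<lambda>P. sqrt (1 - (cos (visual_angle K P))\<^sup>2) ^ m) \<in> borel_measurable ?R" by measurable
  moreover have "sin (visual_angle K P) ^ m = sqrt (1 - (cos (visual_angle K P))\<^sup>2) ^ m" if "P \<in> space ?R" for P
  proof -
    interpret exterior_point K P using that sp ext by blast
    have "0 \<le> sin (visual_angle K P)" using visual_angle_range by (rule sin_ge_zero)
    then show ?thesis by (simp add: cos_squared_eq)
  qed
  ultimately have "(\<lambda>P. sin (visual_angle K P) ^ m) \<in> borel_measurable ?R"
    by (simp cong: measurable_cong)
  then show ?thesis
    unfolding set_borel_measurable_def using op by (simp add: borel_measurable_restrict_space_iff)
qed

section \<open>Parametrization of the boundary by the normal angle\<close>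

lemma inner_DERIV:
  fixes f g :: "real \<Rightarrow> 'a::real_inner"
  assumes "(f has_vector_derivative f') (at t)" "(g has_vector_derivative g') (at t)"
  shows "((\<lambda>s. f s \<bullet> g s) has_real_derivative (f' \<bullet> g t + f t \<bullet> g')) (at t)"
proof -
  have "((\<lambda>s. f s \<bullet> g s) has_derivative (\<lambda>h. f t \<bullet> (h *\<^sub>R g') + (h *\<^sub>R f') \<bullet> g t)) (at t)"
    using assms unfolding has_vector_derivative_def by (rule has_derivative_inner)
  then show ?thesis
    unfolding has_field_derivative_def by (rule has_derivative_eq_rhs) (auto simp: algebra_simps)
qed

lemma unit_at_comp_derivative:
  assumes "(\<nu> has_real_derivative d) (at t)"
  shows "((\<lambda>s. unit_at (\<nu> s)) has_vector_derivative d *\<^sub>R tang_at (\<nu> t)) (at t)"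
    and "((\<lambda>s. tang_at (\<nu> s)) has_vector_derivative - d *\<^sub>R unit_at (\<nu> t)) (at t)"
proof -
  have d: "(\<nu> has_vector_derivative d) (at t)"
    using assms by (simp add: has_real_derivative_iff_has_vector_derivative)
  show "((\<lambda>s. unit_at (\<nu> s)) has_vector_derivative d *\<^sub>R tang_at (\<nu> t)) (at t)"
    using vector_diff_chain_at[OF d unit_at_derivative(1)] by (simp add: o_def)
  show "((\<lambda>s. tang_at (\<nu> s)) has_vector_derivative - d *\<^sub>R unit_at (\<nu> t)) (at t)"
    using vector_diff_chain_at[OF d unit_at_derivative(2)] by (simp add: o_def)
qed

lemma inner_unit_tang [simp]:
  "unit_at a \<bullet> unit_at a = 1" "tang_at a \<bullet> tang_at a = 1" "unit_at a \<bullet> tang_at a = 0" "tang_at a \<bullet> unit_at a = 0"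
  by (simp_all add: dot_square_norm inner_real2)

lemma frame_expand: "v = (v \<bullet> unit_at a) *\<^sub>R unit_at a + (v \<bullet> tang_at a) *\<^sub>R tang_at a"
proof -
  have "(v \<bullet> unit_at a) * cos a - (v \<bullet> tang_at a) * sin a = v$1 * ((sin a)\<^sup>2 + (cos a)\<^sup>2)"
    "(v \<bullet> unit_at a) * sin a + (v \<bullet> tang_at a) * cos a = v$2 * ((sin a)\<^sup>2 + (cos a)\<^sup>2)"
    unfolding inner_real2 unit_at_nth tang_at_nth by algebra+
  then show ?thesis by (simp add: vec_eq_real2)
qed

text \<open>The boundary curve \<open>\<gamma>\<close> runs counterclockwise with speed \<open>\<sigma>\<close>; \<open>\<nu>\<close> is a continuous choice
  of the angle of the outer normal, so that \<open>\<nu>'\<close> is the curvature times \<open>\<sigma>\<close>. One turn takes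
  the parameter from 0 to 1, but the curve is defined on the whole line to avoid one-sided derivatives.\<close>

locale convex_oval =
  fixes K :: "(real^2) set" and \<gamma> :: "real \<Rightarrow> real^2" and \<nu> \<nu>' \<sigma> :: "real \<Rightarrow> real"
  assumes K: "compact K" "convex K" "0 \<in> interior K"
    and \<gamma>_deriv: "\<And>t. (\<gamma> has_vector_derivative \<sigma> t *\<^sub>R tang_at (\<nu> t)) (at t)"
    and \<sigma>_pos: "\<And>t. 0 < \<sigma> t"
    and \<nu>_deriv: "\<And>t. (\<nu> has_real_derivative \<nu>' t) (at t)"
    and \<nu>'_cont: "continuous_on UNIV \<nu>'"
    and closes: "\<gamma> 1 = \<gamma> 0" "tang_at (\<nu> 1) = tang_at (\<nu> 0)"
    and simple: "simple_path \<gamma>"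
    and image: "path_image \<gamma> = frontier K"
    and on_frontier: "\<And>t. \<gamma> t \<in> frontier K"
    and supporting: "\<And>x t. x \<in> K \<Longrightarrow> (x - \<gamma> t) \<bullet> unit_at (\<nu> t) \<le> 0"

lemma antiderivative_exists:
  fixes f :: "real \<Rightarrow> real"
  assumes "continuous_on UNIV f" obtains F where "\<And>x. (F has_real_derivative f x) (at x)"
proof -
  have "isCont f x" for x using assms by (simp add: continuous_on_eq_continuous_at)
  then have "\<exists>F. \<forall>x::real. -\<infinity> < ereal x \<longrightarrow> ereal x < \<infinity> \<longrightarrow> (F has_vector_derivative f x) (at x)"
    by (intro einterval_antiderivative) auto
  then show ?thesis using that by (auto simp: has_real_derivative_iff_has_vector_derivative)
qed

lemma angle_exists:
  assumes "norm (w::real^2) = 1" obtains a where "w = tang_at a"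
proof -
  have "(w$2)\<^sup>2 + (- w$1)\<^sup>2 = 1" using assms norm_sq_real2[of w] by simp
  then obtain a where "w$2 = cos a" "- w$1 = sin a" using sincos_total_2pi_le by blast
  then have "w = tang_at a" by (simp add: vec_eq_real2)
  then show ?thesis by (rule that)
qed

text \<open>Both identities are components of \<open>(w \<bullet> w) z = (w \<bullet> z) w + cross2 w z * J w\<close>, where \<open>J\<close> is the
  rotation by a right angle, in the frame at angle \<open>a\<close>.\<close>

lemma rotation_identity:
  "(w \<bullet> w) * (z \<bullet> unit_at a) + cross2 w z * (w \<bullet> tang_at a) = (w \<bullet> unit_at a) * (w \<bullet> z)"
  "(w \<bullet> w) * (z \<bullet> tang_at a) - cross2 w z * (w \<bullet> unit_at a) = (w \<bullet> tang_at a) * (w \<bullet> z)"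
  unfolding inner_real2 cross2_def unit_at_nth tang_at_nth by algebra+

text \<open>Take for \<open>\<nu>\<close> an antiderivative of the turning speed \<open>cross2 \<delta> \<delta>' / (\<delta> \<bullet> \<delta>)\<close> with the
  right initial value. In the frame that turns with \<open>\<nu>\<close> the normalized vector \<open>\<delta>\<close> has constant
  coordinates \<open>A\<close> and \<open>B\<close>, so it stays equal to the tangent vector of the frame.\<close>

lemma tangent_angle_lift:
  fixes \<delta> \<delta>' :: "real \<Rightarrow> real^2"
  assumes d: "\<And>t. (\<delta> has_vector_derivative \<delta>' t) (at t)" and c: "continuous_on UNIV \<delta>'" and nz: "\<And>t. \<delta> t \<noteq> 0"
  obtains \<nu> \<nu>' where "\<And>t. (\<nu> has_real_derivative \<nu>' t) (at t)" "continuous_on UNIV \<nu>'"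
    "\<And>t. \<delta> t = norm (\<delta> t) *\<^sub>R tang_at (\<nu> t)"
proof -
  define \<kappa> where "\<kappa> t = cross2 (\<delta> t) (\<delta>' t) / (\<delta> t \<bullet> \<delta> t)" for t
  have "continuous_on UNIV \<delta>" by (rule continuous_on_vector_derivative) (rule d)
  then have \<kappa>: "continuous_on UNIV \<kappa>"
    unfolding \<kappa>_def cross2_def using nz c by (intro continuous_intros) auto
  obtain F where F: "\<And>x. (F has_real_derivative \<kappa> x) (at x)" using antiderivative_exists[OF \<kappa>] by blast
  obtain a where a: "\<delta> 0 /\<^sub>R norm (\<delta> 0) = tang_at a"
    using angle_exists[of "\<delta> 0 /\<^sub>R norm (\<delta> 0)"] nz[of 0] by auto
  define \<nu> where "\<nu> t = F t + (a - F 0)" for t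
  have \<nu>: "(\<nu> has_real_derivative \<kappa> t) (at t)" for t
    unfolding \<nu>_def by (auto intro!: derivative_eq_intros F)
  define s where "s t = sqrt (\<delta> t \<bullet> \<delta> t)" for t
  have s: "s t = norm (\<delta> t)" "0 < s t" "s t * s t = \<delta> t \<bullet> \<delta> t" for t
    using nz[of t] by (auto simp: s_def norm_eq_sqrt_inner)
  have ds: "(s has_real_derivative (\<delta> t \<bullet> \<delta>' t) / s t) (at t)" for t
  proof -
    have "((\<lambda>t. sqrt (\<delta> t \<bullet> \<delta> t)) has_real_derivative (inverse (sqrt (\<delta> t \<bullet> \<delta> t)) / 2) * (\<delta>' t \<bullet> \<delta> t + \<delta> t \<bullet> \<delta>' t)) (at t)"
      by (rule DERIV_chain2[OF DERIV_real_sqrt inner_DERIV[OF d d]]) (use nz in simp)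
    moreover have "inverse (sqrt (\<delta> t \<bullet> \<delta> t)) / 2 * (\<delta>' t \<bullet> \<delta> t + \<delta> t \<bullet> \<delta>' t) = (\<delta> t \<bullet> \<delta>' t) / s t"
      unfolding s_def inner_commute[of "\<delta>' t"] by (simp add: field_simps)
    ultimately show ?thesis unfolding s_def by simp
  qed
  define A where "A t = (\<delta> t \<bullet> unit_at (\<nu> t)) / s t" for t
  define B where "B t = (\<delta> t \<bullet> tang_at (\<nu> t)) / s t" for t
  have "DERIV A t :> 0" for t
  proof -
    have "(A has_real_derivative ((\<delta>' t \<bullet> unit_at (\<nu> t) + \<delta> t \<bullet> (\<kappa> t *\<^sub>R tang_at (\<nu> t))) * s t - (\<delta> t \<bullet> unit_at (\<nu> t)) * ((\<delta> t \<bullet> \<delta>' t) / s t)) / (s t * s t)) (at t)"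
      unfolding A_def[abs_def]
      using s(2)[of t] by (intro DERIV_divide inner_DERIV d unit_at_comp_derivative \<nu> ds) auto
    moreover have "(\<delta>' t \<bullet> unit_at (\<nu> t) + \<delta> t \<bullet> (\<kappa> t *\<^sub>R tang_at (\<nu> t))) * s t - (\<delta> t \<bullet> unit_at (\<nu> t)) * ((\<delta> t \<bullet> \<delta>' t) / s t) = 0"
    proof -
      have "((\<delta> t \<bullet> \<delta> t) * (\<delta>' t \<bullet> unit_at (\<nu> t)) + cross2 (\<delta> t) (\<delta>' t) * (\<delta> t \<bullet> tang_at (\<nu> t)) - (\<delta> t \<bullet> unit_at (\<nu> t)) * (\<delta> t \<bullet> \<delta>' t)) / s t = 0"
        unfolding rotation_identity(1) by simp
      moreover have "cross2 (\<delta> t) (\<delta>' t) = \<kappa> t * (s t * s t)" using nz by (simp add: \<kappa>_def s(3))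
      ultimately show ?thesis using s(2)[of t] unfolding s(3)[symmetric] by (simp add: field_simps)
    qed
    ultimately show ?thesis by simp
  qed
  then have "A t = A 0" for t by (intro DERIV_isconst_all) blast
  moreover have "DERIV B t :> 0" for t
  proof -
    have "(B has_real_derivative ((\<delta>' t \<bullet> tang_at (\<nu> t) + \<delta> t \<bullet> (- \<kappa> t *\<^sub>R unit_at (\<nu> t))) * s t - (\<delta> t \<bullet> tang_at (\<nu> t)) * ((\<delta> t \<bullet> \<delta>' t) / s t)) / (s t * s t)) (at t)"
      unfolding B_def[abs_def]
      using s(2)[of t] by (intro DERIV_divide inner_DERIV d unit_at_comp_derivative \<nu> ds) auto
    moreover have "(\<delta>' t \<bullet> tang_at (\<nu> t) + \<delta> t \<bullet> (- \<kappa> t *\<^sub>R unit_at (\<nu> t))) * s t - (\<delta> t \<bullet> tang_at (\<nu> t)) * ((\<delta> t \<bullet> \<delta>' t) / s t) = 0"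
    proof -
      have "((\<delta> t \<bullet> \<delta> t) * (\<delta>' t \<bullet> tang_at (\<nu> t)) - cross2 (\<delta> t) (\<delta>' t) * (\<delta> t \<bullet> unit_at (\<nu> t)) - (\<delta> t \<bullet> tang_at (\<nu> t)) * (\<delta> t \<bullet> \<delta>' t)) / s t = 0"
        unfolding rotation_identity(2) by simp
      moreover have "cross2 (\<delta> t) (\<delta>' t) = \<kappa> t * (s t * s t)" using nz by (simp add: \<kappa>_def s(3))
      ultimately show ?thesis using s(2)[of t] unfolding s(3)[symmetric] by (simp add: field_simps)
    qed
    ultimately show ?thesis by simp
  qed
  then have "B t = B 0" for t by (intro DERIV_isconst_all) blast
  moreover have "\<nu> 0 = a" by (simp add: \<nu>_def)
  moreover have "\<delta> 0 = s 0 *\<^sub>R tang_at a"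
    unfolding a[symmetric] s(1) using nz[of 0] by simp
  ultimately have AB: "\<delta> t \<bullet> unit_at (\<nu> t) = 0" "\<delta> t \<bullet> tang_at (\<nu> t) = s t" for t
    using s(2) by (simp_all add: A_def B_def field_simps less_imp_neq[symmetric])
  have "\<delta> t = norm (\<delta> t) *\<^sub>R tang_at (\<nu> t)" for t
    using frame_expand[of "\<delta> t" "\<nu> t"] by (simp add: AB s(1))
  with \<nu> \<kappa> show ?thesis by (rule that)
qed

text \<open>A functional that supports \<open>K\<close> at \<open>\<gamma> t\<close> is minimal along the curve at \<open>t\<close>, hence vanishes on
  \<open>\<gamma>' t\<close>; it is therefore a multiple of \<open>cross2 (\<gamma>' t)\<close>. Since the origin is an interior point,
  the sign of the multiple is that of \<open>cross2 (\<gamma> t) (\<gamma>' t)\<close>.\<close>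

lemma boundary_curve_supported:
  fixes \<gamma> \<gamma>' :: "real \<Rightarrow> real^2"
  assumes K: "convex K" "0 \<in> interior K" "closed K"
    and d: "(\<gamma> has_vector_derivative \<gamma>' t) (at t)" "\<gamma>' t \<noteq> 0"
    and fr: "\<And>s. \<gamma> s \<in> frontier K"
  shows "cross2 (\<gamma> t) (\<gamma>' t) \<noteq> 0"
    and "\<And>x. x \<in> K \<Longrightarrow> 0 \<le> cross2 (\<gamma> t) (\<gamma>' t) * cross2 (\<gamma>' t) (x - \<gamma> t)"
proof -
  have ri: "rel_interior K = interior K" using K(2) by (intro rel_interior_nonempty_interior) auto
  have clo: "closure K = K" using K(3) by simp
  have mem: "\<gamma> s \<in> K" for s using fr[of s] clo by (auto simp: frontier_def)
  obtain a where a: "a \<noteq> 0" "\<And>y. y \<in> K \<Longrightarrow> a \<bullet> \<gamma> t \<le> a \<bullet> y" "\<And>y. y \<in> interior K \<Longrightarrow> a \<bullet> \<gamma> t < a \<bullet> y"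
    using supporting_hyperplane_relative_frontier[OF K(1), of "\<gamma> t"] fr[of t] unfolding ri clo
    by (auto simp: frontier_def clo)
  have "((\<lambda>s. a \<bullet> \<gamma> s) has_real_derivative (0 \<bullet> \<gamma> t + a \<bullet> \<gamma>' t)) (at t)"
    by (intro inner_DERIV d has_vector_derivative_const)
  then have "0 \<bullet> \<gamma> t + a \<bullet> \<gamma>' t = 0"
    by (rule DERIV_local_min[where d = 1]) (auto simp: a(2) mem)
  then have 0: "a \<bullet> \<gamma>' t = 0" by simp
  define c where "c = cross2 (\<gamma>' t) a"
  have key: "(\<gamma>' t \<bullet> \<gamma>' t) * (a \<bullet> v) = c * cross2 (\<gamma>' t) v" for v
  proof -
    have "(\<gamma>' t \<bullet> \<gamma>' t) * (a \<bullet> v) = c * cross2 (\<gamma>' t) v + (a \<bullet> \<gamma>' t) * (\<gamma>' t \<bullet> v)"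
      unfolding c_def cross2_def inner_real2 by algebra
    then show ?thesis by (simp add: 0)
  qed
  have pos: "0 < \<gamma>' t \<bullet> \<gamma>' t" using d(2) by simp
  have "0 < (\<gamma>' t \<bullet> \<gamma>' t) * (a \<bullet> (0 - \<gamma> t))"
    using pos a(3)[OF K(2)] by (simp add: mult_pos_pos mult_pos_neg)
  also have "\<dots> = c * cross2 (\<gamma> t) (\<gamma>' t)" unfolding key by (simp add: cross2_def)
  finally have cD: "0 < c * cross2 (\<gamma> t) (\<gamma>' t)" .
  then show "cross2 (\<gamma> t) (\<gamma>' t) \<noteq> 0" by auto
  fix x assume "x \<in> K"
  then have "0 \<le> (\<gamma>' t \<bullet> \<gamma>' t) * (a \<bullet> (x - \<gamma> t))" using a(2) by (simp add: inner_diff_right)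
  also have "\<dots> = c * cross2 (\<gamma>' t) (x - \<gamma> t)" by (rule key)
  finally show "0 \<le> cross2 (\<gamma> t) (\<gamma>' t) * cross2 (\<gamma>' t) (x - \<gamma> t)"
    using cD by (auto simp: zero_le_mult_iff zero_less_mult_iff)
qed

text \<open>The quantity \<open>cross2 (\<gamma> t) (\<gamma>' t)\<close> never vanishes, so a curve that runs counterclockwise at one
  parameter does so everywhere, and \<open>K\<close> stays on its left.\<close>

lemma convex_oval_of_parametrization:
  fixes \<gamma> \<gamma>' \<gamma>'' :: "real \<Rightarrow> real^2"
  assumes K: "compact K" "convex K" "0 \<in> interior K"
    and d: "\<And>t. (\<gamma> has_vector_derivative \<gamma>' t) (at t)" "\<And>t. (\<gamma>' has_vector_derivative \<gamma>'' t) (at t)"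
      "continuous_on UNIV \<gamma>''" "\<And>t. \<gamma>' t \<noteq> 0"
    and per: "\<And>t. \<gamma> (t + 1) = \<gamma> t" and simple: "simple_path \<gamma>" and im: "path_image \<gamma> = frontier K"
    and fr: "\<And>s. \<gamma> s \<in> frontier K"
    and pos: "0 < cross2 (\<gamma> 0) (\<gamma>' 0)"
  shows "\<exists>\<nu> \<nu>' \<sigma>. convex_oval K \<gamma> \<nu> \<nu>' \<sigma>"
proof -
  have clo: "closed K" using K(1) by (rule compact_imp_closed)
  have nz: "cross2 (\<gamma> t) (\<gamma>' t) \<noteq> 0" for t
    using boundary_curve_supported(1)[where \<gamma> = \<gamma> and \<gamma>' = \<gamma>', OF K(2,3) clo d(1,4) fr] .
  have cont: "continuous_on UNIV \<gamma>" "continuous_on UNIV \<gamma>'"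
    using d(1,2) by (auto intro: continuous_on_vector_derivative)
  have D: "0 < cross2 (\<gamma> t) (\<gamma>' t)" for t
  proof (rule ccontr)
    assume "\<not> ?thesis"
    moreover have "connected (range (\<lambda>t. cross2 (\<gamma> t) (\<gamma>' t)))"
      unfolding cross2_def by (intro connected_continuous_image continuous_intros cont) auto
    ultimately have "0 \<in> range (\<lambda>t. cross2 (\<gamma> t) (\<gamma>' t))"
      using pos unfolding connected_iff_interval by (meson rangeI less_imp_le not_less)
    then show False using nz by auto
  qed
  have sup: "0 \<le> cross2 (\<gamma>' t) (x - \<gamma> t)" if "x \<in> K" for x t
    using boundary_curve_supported(2)[where \<gamma> = \<gamma> and \<gamma>' = \<gamma>', OF K(2,3) clo d(1,4) fr that, of t] D[of t]
    by (simp add: zero_le_mult_iff)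
  obtain \<nu> \<nu>' where \<nu>: "\<And>t. (\<nu> has_real_derivative \<nu>' t) (at t)" "continuous_on UNIV \<nu>'"
    "\<And>t. \<gamma>' t = norm (\<gamma>' t) *\<^sub>R tang_at (\<nu> t)"
    using tangent_angle_lift[OF d(2,3,4)] by metis
  have "convex_oval K \<gamma> \<nu> \<nu>' (\<lambda>t. norm (\<gamma>' t))"
  proof
    show "(\<gamma> has_vector_derivative norm (\<gamma>' t) *\<^sub>R tang_at (\<nu> t)) (at t)" for t
      using d(1) \<nu>(3) by metis
    show "0 < norm (\<gamma>' t)" for t using d(4) by simp
    show "\<gamma> 1 = \<gamma> 0" using per[of 0] by simp
    have "((\<lambda>t. \<gamma> (t + 1)) has_vector_derivative \<gamma>' 1) (at 0)"
      using vector_diff_chain_at[of "\<lambda>t. t + 1" 1 0 \<gamma> "\<gamma>' 1"] d(1)[of 1]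
      by (simp add: o_def has_vector_derivative_add_const)
    then have "(\<gamma> has_vector_derivative \<gamma>' 1) (at 0)" by (simp add: per)
    with d(1)[of 0] have eq: "\<gamma>' 1 = \<gamma>' 0" by (rule vector_derivative_unique_at[symmetric])
    have "norm (\<gamma>' 0) *\<^sub>R tang_at (\<nu> 1) = norm (\<gamma>' 0) *\<^sub>R tang_at (\<nu> 0)"
      using \<nu>(3)[of 1] \<nu>(3)[of 0] unfolding eq by simp
    then show "tang_at (\<nu> 1) = tang_at (\<nu> 0)" using d(4)[of 0] by simp
    fix x t assume "x \<in> K"
    then have "0 \<le> cross2 (\<gamma>' t) (x - \<gamma> t)" by (rule sup)
    also have "\<dots> = norm (\<gamma>' t) * cross2 (tang_at (\<nu> t)) (x - \<gamma> t)"
      by (subst \<nu>(3)) (simp add: cross2_def algebra_simps)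
    also have "cross2 (tang_at (\<nu> t)) (x - \<gamma> t) = - ((x - \<gamma> t) \<bullet> unit_at (\<nu> t))"
      by (simp add: cross2_def inner_real2)
    finally show "(x - \<gamma> t) \<bullet> unit_at (\<nu> t) \<le> 0"
      using d(4)[of t] by (simp add: mult_le_0_iff)
  qed (use K \<nu> simple im fr in auto)
  then show ?thesis by blast
qed

text \<open>A clockwise parametrization is reversed.\<close>

lemma C2_boundary_imp_convex_oval:
  assumes K: "compact K" "convex K" "C2_boundary K" "0 \<in> interior K"
  shows "\<exists>\<gamma> \<nu> \<nu>' \<sigma>. convex_oval K \<gamma> \<nu> \<nu>' \<sigma>"
proof -
  obtain \<gamma> \<gamma>' \<gamma>'' where d: "\<And>t. (\<gamma> has_vector_derivative \<gamma>' t) (at t)" "\<And>t. (\<gamma>' has_vector_derivative \<gamma>'' t) (at t)"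
      "continuous_on UNIV \<gamma>''" "\<And>t. \<gamma>' t \<noteq> 0"
    and per: "\<And>t. \<gamma> (t + 1) = \<gamma> t" and simple: "simple_path \<gamma>" and im: "path_image \<gamma> = frontier K"
    using K(3) unfolding C2_boundary_def by metis
  have pern: "\<gamma> (t + real n) = \<gamma> t" for t n
    by (induction n) (use per in \<open>auto simp: add.assoc[symmetric] add.commute[of 1]\<close>)
  have fr: "\<gamma> s \<in> frontier K" for s
  proof -
    have "\<gamma> (frac s) = \<gamma> s"
    proof (cases "\<lfloor>s\<rfloor> \<ge> 0")
      case True
      then have "frac s + real (nat \<lfloor>s\<rfloor>) = s" by (simp add: frac_def)
      then show ?thesis using pern[of "frac s" "nat \<lfloor>s\<rfloor>"] by simp
    next
      case False
      then have "s + real (nat (- \<lfloor>s\<rfloor>)) = frac s" by (simp add: frac_def)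
      then show ?thesis using pern[of s "nat (- \<lfloor>s\<rfloor>)"] by simp
    qed
    moreover have "frac s \<in> {0..1}" using frac_lt_1[of s] by (simp add: less_imp_le)
    ultimately show ?thesis unfolding im[symmetric] path_image_def by (metis imageI)
  qed
  have clo: "closed K" using K(1) by (rule compact_imp_closed)
  have nz: "cross2 (\<gamma> 0) (\<gamma>' 0) \<noteq> 0"
    using boundary_curve_supported(1)[where \<gamma> = \<gamma> and \<gamma>' = \<gamma>', OF K(2,4) clo d(1,4) fr] .
  show ?thesis
  proof (cases "0 < cross2 (\<gamma> 0) (\<gamma>' 0)")
    case True
    then show ?thesis using convex_oval_of_parametrization[OF K(1,2,4) d per simple im fr] by blast
  next
    case False
    define \<beta> where "\<beta> = (\<lambda>t. \<gamma> (- t))"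
    have neg: "((\<lambda>t. - t) has_vector_derivative (- 1::real)) (at t)" for t :: real
      by (auto intro!: derivative_eq_intros)
    have b1: "(\<beta> has_vector_derivative - \<gamma>' (- t)) (at t)" for t
      using vector_diff_chain_at[OF neg, of \<gamma> "\<gamma>' (- t)" t] d(1)[of "- t"] by (simp add: o_def \<beta>_def)
    have b2: "((\<lambda>t. - \<gamma>' (- t)) has_vector_derivative \<gamma>'' (- t)) (at t)" for t
      using has_vector_derivative_minus[OF vector_diff_chain_at[OF neg, of \<gamma>' "\<gamma>'' (- t)" t]] d(2)[of "- t"] by (simp add: o_def)
    have rev: "\<beta> = reversepath \<gamma>"
      unfolding \<beta>_def reversepath_def using per by (metis (no_types, opaque_lifting) add.commute uminus_add_conv_diff)
    have "\<exists>\<nu> \<nu>' \<sigma>. convex_oval K \<beta> \<nu> \<nu>' \<sigma>"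
    proof (rule convex_oval_of_parametrization[OF K(1,2,4) b1 b2])
      show "continuous_on UNIV (\<lambda>t. \<gamma>'' (- t))"
        by (intro continuous_on_compose2[OF d(3)] continuous_intros) auto
      show "- \<gamma>' (- t) \<noteq> 0" for t using d(4) by simp
      show "\<beta> (t + 1) = \<beta> t" for t using per[of "- (t + 1)"] by (simp add: \<beta>_def)
      show "simple_path \<beta>" "path_image \<beta> = frontier K"
        unfolding rev using simple im by (simp_all add: simple_path_reversepath)
      show "\<beta> s \<in> frontier K" for s unfolding \<beta>_def by (rule fr)
      have "cross2 (\<beta> 0) (- \<gamma>' (- 0)) = - cross2 (\<gamma> 0) (\<gamma>' 0)" by (simp add: \<beta>_def cross2_def)
      then show "0 < cross2 (\<beta> 0) (- \<gamma>' (- 0))" using False nz by linarith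
    qed
    then show ?thesis by blast
  qed
qed

context convex_oval
begin

lemma on_K: "\<gamma> t \<in> K"
  using on_frontier[of t] compact_imp_closed[OF K(1)] by (auto simp: frontier_def)

lemma K_nonempty: "K \<noteq> {}" and interior_nonempty: "interior K \<noteq> {}" and zero_in: "0 \<in> K"
  using K(3) interior_subset by auto

lemma support_fun_on_curve: "support_fun K (\<nu> t) = \<gamma> t \<bullet> unit_at (\<nu> t)"
proof -
  obtain x where x: "x \<in> K" "support_fun K (\<nu> t) = x \<bullet> unit_at (\<nu> t)"
    using support_fun_attained[OF K(1) K_nonempty] by blast
  then show ?thesis
    using supporting[OF x(1), of t] support_fun_ge[OF K(1) on_K, of t "\<nu> t"] by (simp add: inner_diff_left)
qed

text \<open>Adding the supporting inequalities at \<open>s\<close> and \<open>t\<close> shows that points and normals of the boundary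
  move in the same direction; dividing by \<open>(s - t)\<^sup>2\<close> and letting \<open>s\<close> tend to \<open>t\<close> gives
  \<open>\<sigma> t * \<nu>' t \<ge> 0\<close>.\<close>

lemma angular_speed_nonneg: "0 \<le> \<nu>' t"
proof -
  define q where "q f s = (f s - f t) / (s - t)" for f :: "real \<Rightarrow> real" and s
  have d: "((\<lambda>s. \<gamma> s $ i) has_real_derivative (\<sigma> t *\<^sub>R tang_at (\<nu> t)) $ i) (at t)" for i
    using \<gamma>_deriv[of t, THEN bounded_linear.has_vector_derivative[OF bounded_linear_vec_nth[of i]]]
    by (simp add: has_real_derivative_iff_has_vector_derivative)
  have u: "((\<lambda>s. unit_at (\<nu> s) $ i) has_real_derivative (\<nu>' t *\<^sub>R tang_at (\<nu> t)) $ i) (at t)" for i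
    using unit_at_comp_derivative(1)[OF \<nu>_deriv[of t], THEN bounded_linear.has_vector_derivative[OF bounded_linear_vec_nth[of i]]]
    by (simp add: has_real_derivative_iff_has_vector_derivative)
  let ?Q = "\<lambda>s. q (\<lambda>s. \<gamma> s $ 1) s * q (\<lambda>s. unit_at (\<nu> s) $ 1) s + q (\<lambda>s. \<gamma> s $ 2) s * q (\<lambda>s. unit_at (\<nu> s) $ 2) s"
  have "(?Q \<longlongrightarrow> (\<sigma> t *\<^sub>R tang_at (\<nu> t)) $ 1 * (\<nu>' t *\<^sub>R tang_at (\<nu> t)) $ 1
      + (\<sigma> t *\<^sub>R tang_at (\<nu> t)) $ 2 * (\<nu>' t *\<^sub>R tang_at (\<nu> t)) $ 2) (at t)"
    using d u unfolding q_def has_field_derivative_iff by (intro tendsto_add tendsto_mult) blast+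
  also have "(\<sigma> t *\<^sub>R tang_at (\<nu> t)) $ 1 * (\<nu>' t *\<^sub>R tang_at (\<nu> t)) $ 1
      + (\<sigma> t *\<^sub>R tang_at (\<nu> t)) $ 2 * (\<nu>' t *\<^sub>R tang_at (\<nu> t)) $ 2
      = \<sigma> t * \<nu>' t * ((sin (\<nu> t))\<^sup>2 + (cos (\<nu> t))\<^sup>2)"
    unfolding vector_scaleR_component tang_at_nth real_scaleR_def by algebra
  finally have lim: "(?Q \<longlongrightarrow> \<sigma> t * \<nu>' t) (at t)" by simp
  have "0 \<le> ?Q s" for s
  proof -
    have "?Q s = ((\<gamma> s - \<gamma> t) \<bullet> (unit_at (\<nu> s) - unit_at (\<nu> t))) / (s - t)\<^sup>2"
      by (simp add: q_def inner_real2 power2_eq_square add_divide_distrib)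
    moreover have "0 \<le> (\<gamma> s - \<gamma> t) \<bullet> (unit_at (\<nu> s) - unit_at (\<nu> t))"
      using supporting[OF on_K, of t s] supporting[OF on_K, of s t]
      by (simp add: inner_diff_left inner_diff_right)
    ultimately show ?thesis by simp
  qed
  then have "0 \<le> \<sigma> t * \<nu>' t" by (intro tendsto_lowerbound[OF lim]) auto
  then show ?thesis using \<sigma>_pos[of t] by (simp add: zero_le_mult_iff)
qed

text \<open>For a second contact point \<open>x\<close>, the nonpositive function \<open>(x - \<gamma> e) \<bullet> unit_at (\<nu> e)\<close> of \<open>e\<close>
  vanishes at \<open>s\<close>, so its derivative \<open>\<nu>' s * ((x - \<gamma> s) \<bullet> tang_at (\<nu> s))\<close> is zero there.\<close>

lemma contact_point_unique:
  assumes x: "x \<in> K" "(x - \<gamma> s) \<bullet> unit_at (\<nu> s) = 0" and pos: "0 < \<nu>' s"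
  shows "x = \<gamma> s"
proof -
  have "((\<lambda>e. x - \<gamma> e) has_vector_derivative (0 - \<sigma> s *\<^sub>R tang_at (\<nu> s))) (at s)"
    by (intro has_vector_derivative_diff has_vector_derivative_const \<gamma>_deriv)
  then have "((\<lambda>e. (x - \<gamma> e) \<bullet> unit_at (\<nu> e)) has_real_derivative
     ((0 - \<sigma> s *\<^sub>R tang_at (\<nu> s)) \<bullet> unit_at (\<nu> s) + (x - \<gamma> s) \<bullet> (\<nu>' s *\<^sub>R tang_at (\<nu> s)))) (at s)"
    by (intro inner_DERIV unit_at_comp_derivative \<nu>_deriv)
  then have "(0 - \<sigma> s *\<^sub>R tang_at (\<nu> s)) \<bullet> unit_at (\<nu> s) + (x - \<gamma> s) \<bullet> (\<nu>' s *\<^sub>R tang_at (\<nu> s)) = 0"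
    by (rule DERIV_local_max[where d = 1]) (use x(2) supporting[OF x(1)] in auto)
  then have "(x - \<gamma> s) \<bullet> tang_at (\<nu> s) = 0" using pos by simp
  then show ?thesis using frame_expand[of "x - \<gamma> s" "\<nu> s"] x(2) by simp
qed

lemma curve_inj:
  assumes "\<gamma> s = \<gamma> t" "s \<in> {0..<1}" "t \<in> {0..<1}" shows "s = t"
proof -
  have "\<forall>x\<in>{0..1}. \<forall>y\<in>{0..1}. \<gamma> x = \<gamma> y \<longrightarrow> x = y \<or> x = 0 \<and> y = 1 \<or> x = 1 \<and> y = 0"
    using simple by (simp add: simple_path_def loop_free_def)
  from this[rule_format, of s t] show ?thesis using assms by auto
qed

lemma continuous_on_\<nu>: "continuous_on S \<nu>"
  by (meson DERIV_continuous_on \<nu>_deriv has_field_derivative_at_within)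

lemma angle_mono: "s \<le> t \<Longrightarrow> \<nu> s \<le> \<nu> t"
  by (erule DERIV_nonneg_imp_nondecreasing) (use \<nu>_deriv angular_speed_nonneg in blast)

text \<open>The total turning is a multiple of \<open>2\<pi>\<close>. It is positive since otherwise \<open>\<gamma>\<close> would progress
  forever in one direction. If it were at least \<open>4\<pi>\<close>, then every normal direction would occur at
  two parameters or more; where the angular speed is positive, the contact point is unique, so that the curve
  would visit it twice.\<close>

lemma turning_number_one: "\<nu> 1 = \<nu> 0 + 2 * pi"
proof -
  have "sin (\<nu> 1) = sin (\<nu> 0)" "cos (\<nu> 1) = cos (\<nu> 0)"
    using closes(2) by (auto simp: vec_eq_real2)
  then obtain n :: int where n: "\<nu> 1 = \<nu> 0 + 2 * pi * n" using sin_cos_eq_iff by blast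
  have "\<nu> 0 < \<nu> 1"
  proof (rule ccontr)
    assume "\<not> ?thesis"
    then have const: "\<nu> t = \<nu> 0" if "0 \<le> t" "t \<le> 1" for t
      using angle_mono[OF that(1)] angle_mono[OF that(2)] by simp
    have D: "((\<lambda>t. \<gamma> t \<bullet> tang_at (\<nu> 0)) has_real_derivative ((\<sigma> t *\<^sub>R tang_at (\<nu> t)) \<bullet> tang_at (\<nu> 0) + \<gamma> t \<bullet> 0)) (at t)" for t
      by (intro inner_DERIV \<gamma>_deriv has_vector_derivative_const)
    have "((\<lambda>t. \<gamma> t \<bullet> tang_at (\<nu> 0)) has_real_derivative \<sigma> t) (at t)" if "0 \<le> t" "t \<le> 1" for t
      using D[of t] by (simp add: const[OF that])
    then have "\<gamma> 0 \<bullet> tang_at (\<nu> 0) < \<gamma> 1 \<bullet> tang_at (\<nu> 0)"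
      using \<sigma>_pos by (intro DERIV_pos_imp_increasing[OF zero_less_one]) blast
    then show False using closes(1) by simp
  qed
  then have "0 < pi * real_of_int n" using n by simp
  then have n1: "1 \<le> n" by (simp add: zero_less_mult_iff)
  have "n < 2"
  proof (rule ccontr)
    assume "\<not> n < 2"
    then have "pi * 2 \<le> pi * real_of_int n" by (intro mult_left_mono) auto
    then have big: "\<nu> 0 + 4 * pi \<le> \<nu> 1" using n by simp
    obtain z where z: "0 < z" "z < 1" "\<nu> 1 - \<nu> 0 = (1 - 0) * \<nu>' z"
      using MVT2[of 0 1 \<nu> \<nu>'] \<nu>_deriv by auto
    have "\<nu> 1 - \<nu> 0 = \<nu>' z" using z(3) by simp
    then have pos: "0 < \<nu>' z" using big pi_gt_zero by linarith
    have r: "\<nu> 0 \<le> \<nu> z" "\<nu> z \<le> \<nu> 1" using angle_mono z by auto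
    \<comment> \<open>one of the two neighbouring turns of \<open>\<nu> z\<close> is still in the range of \<open>\<nu>\<close>\<close>
    obtain y where y: "\<nu> 0 \<le> y" "y \<le> \<nu> 1" "y \<noteq> \<nu> z" "unit_at y = unit_at (\<nu> z)"
    proof (cases "\<nu> z + 2 * pi \<le> \<nu> 1")
      case True
      moreover have "\<nu> 0 \<le> \<nu> z + 2 * pi" using r pi_gt_zero by linarith
      ultimately show ?thesis using that[of "\<nu> z + 2 * pi"] by (simp add: unit_at_periodic)
    next
      case False
      then have "\<nu> 0 \<le> \<nu> z - 2 * pi" "\<nu> z - 2 * pi \<le> \<nu> 1" using r big pi_gt_zero by linarith+
      then show ?thesis using that[of "\<nu> z - 2 * pi"] unit_at_periodic[of "\<nu> z - 2 * pi"] by simp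
    qed
    obtain s where s: "0 \<le> s" "s \<le> 1" "\<nu> s = y"
      using IVT'[of \<nu> 0 y 1] y continuous_on_\<nu> by auto
    have "support_fun K (\<nu> s) = support_fun K (\<nu> z)" by (simp add: support_fun_def s(3) y(4))
    then have "(\<gamma> s - \<gamma> z) \<bullet> unit_at (\<nu> z) = 0"
      using support_fun_on_curve[of s] support_fun_on_curve[of z] by (simp add: inner_diff_left s(3) y(4))
    then have "\<gamma> s = \<gamma> z" using contact_point_unique[OF on_K _ pos] by blast
    moreover have "s \<noteq> z" using s(3) y(3) by auto
    moreover have "\<forall>x\<in>{0..1}. \<forall>y\<in>{0..1}. \<gamma> x = \<gamma> y \<longrightarrow> x = y \<or> x = 0 \<and> y = 1 \<or> x = 1 \<and> y = 0"
      using simple by (simp add: simple_path_def loop_free_def)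
    from this[rule_format, of s z] have "\<gamma> s = \<gamma> z \<Longrightarrow> s = z" using s z by auto
    ultimately show False by blast
  qed
  with n1 have "n = 1" by simp
  then show ?thesis using n by simp
qed

section \<open>Sweeping the exterior with half-tangents\<close>

definition sweep :: "real^2 \<Rightarrow> real^2" where
  "sweep x = \<gamma> (x$1) + x$2 *\<^sub>R tang_at (\<nu> (x$1))"

text \<open>Let \<open>B\<close> be the later of the two contact points seen from \<open>P\<close> in counterclockwise order. Along the
  boundary the function \<open>cross2 (\<gamma> s - P) (B - P)\<close> has its minimum 0 at \<open>B\<close>, so \<open>P\<close> lies on the
  tangent line at \<open>B\<close>; the origin decides on which side of \<open>B\<close>.\<close>

lemma exterior_covered:
  assumes P: "P \<notin> K"
  obtains x where "P = sweep x" "0 \<le> x$1" "x$1 < 1" "0 < x$2"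
proof -
  interpret ext: exterior_point K P using K P interior_nonempty by unfold_locales
  obtain A B where AB: "tangent_pair K P A B" using tangent_pair_exists[OF K(1,2) K_nonempty P] .
  define b where "b = B - P"
  have b0: "b \<noteq> 0" unfolding b_def using ext.tangent_pair_nonzero[OF AB] by simp
  have cr: "0 \<le> cross2 (x - P) b" if "x \<in> K" for x using AB that by (simp add: tangent_pair_def b_def)
  obtain t0 where t0: "t0 \<in> {0..1}" "\<gamma> t0 = B"
    using ext.tangent_pair_frontier(2)[OF AB] unfolding image[symmetric] path_image_def by blast
  obtain t where t: "0 \<le> t" "t < 1" "\<gamma> t = B"
    using t0 closes(1) by (cases "t0 = 1") (use that[of 0] that[of t0] in auto)
  let ?w = "vector [b$2, - b$1] :: real^2"
  have cw: "cross2 v b = v \<bullet> ?w" for v by (simp add: cross2_def inner_real2)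
  have "((\<lambda>s. \<gamma> s - P) has_vector_derivative (\<sigma> t *\<^sub>R tang_at (\<nu> t) - 0)) (at t)"
    by (intro has_vector_derivative_diff has_vector_derivative_const \<gamma>_deriv)
  then have "((\<lambda>s. (\<gamma> s - P) \<bullet> ?w) has_real_derivative ((\<sigma> t *\<^sub>R tang_at (\<nu> t) - 0) \<bullet> ?w + (\<gamma> t - P) \<bullet> 0)) (at t)"
    by (intro inner_DERIV has_vector_derivative_const)
  then have "(\<sigma> t *\<^sub>R tang_at (\<nu> t) - 0) \<bullet> ?w + (\<gamma> t - P) \<bullet> 0 = 0"
  proof (rule DERIV_local_min[where d = 1])
    show "\<forall>y. \<bar>t - y\<bar> < 1 \<longrightarrow> (\<gamma> t - P) \<bullet> ?w \<le> (\<gamma> y - P) \<bullet> ?w"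
      using cr[OF on_K] unfolding cw[symmetric] by (simp add: t(3) b_def[symmetric])
  qed simp
  then have "cross2 (tang_at (\<nu> t)) b = 0" using \<sigma>_pos[of t] by (simp add: cw)
  moreover have "cross2 (tang_at (\<nu> t)) b = - (b \<bullet> unit_at (\<nu> t))"
    by (simp add: cross2_def inner_real2 algebra_simps)
  ultimately have bu: "b \<bullet> unit_at (\<nu> t) = 0" by simp
  define r where "r = - (b \<bullet> tang_at (\<nu> t))"
  have b: "b = - r *\<^sub>R tang_at (\<nu> t)" using frame_expand[of b "\<nu> t"] by (simp add: bu r_def)
  have P: "P = \<gamma> t + r *\<^sub>R tang_at (\<nu> t)" using b t(3) by (simp add: b_def algebra_simps)
  have "cross2 (0 - P) b = r * (P \<bullet> unit_at (\<nu> t))"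
    unfolding b by (simp add: cross2_def inner_real2 algebra_simps)
  also have "P \<bullet> unit_at (\<nu> t) = support_fun K (\<nu> t)" unfolding P support_fun_on_curve by (simp add: inner_add_left)
  finally have "0 \<le> r * support_fun K (\<nu> t)" using cr[OF zero_in] by simp
  then have "0 \<le> r" using support_fun_pos[OF K(1,3), of "\<nu> t"] by (simp add: zero_le_mult_iff)
  moreover have "r \<noteq> 0" using b b0 by auto
  ultimately show ?thesis using that[of "vector [t, r]"] t P by (simp add: sweep_def)
qed

lemma sweep_outside:
  assumes "0 < x$2" "0 < \<nu>' (x$1)" shows "sweep x \<notin> K"
proof
  assume "sweep x \<in> K"
  moreover have "(sweep x - \<gamma> (x$1)) \<bullet> unit_at (\<nu> (x$1)) = 0" by (simp add: sweep_def)
  ultimately have "sweep x = \<gamma> (x$1)" using contact_point_unique assms(2) by blast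
  then have "x$2 *\<^sub>R tang_at (\<nu> (x$1)) = 0" by (simp add: sweep_def)
  then show False using assms(1) norm_tang_at[of "\<nu> (x$1)"] by auto
qed

text \<open>Restricting to positive angular speed makes the sweep injective and its Jacobian nonzero; the rest
  of the strip contributes nothing to the integrals, since \<open>\<nu>'\<close> vanishes there.\<close>

definition sweep_domain :: "(real^2) set" where
  "sweep_domain = {x. 0 \<le> x$1 \<and> x$1 < 1 \<and> 0 < x$2 \<and> 0 < \<nu>' (x$1)}"

text \<open>Each of the two contact points lies in the supporting half-plane at the other one. These two
  conditions bound the sine of the angle between the tangents from both sides, so that it vanishes and
  the two contact points lie on one supporting line.\<close>

lemma sweep_inj: "inj_on sweep sweep_domain"
proof
  fix x y assume x: "x \<in> sweep_domain" and y: "y \<in> sweep_domain" and eq: "sweep x = sweep y"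
  define a b where "a = \<nu> (x$1)" and "b = \<nu> (y$1)"
  have e: "\<gamma> (y$1) - \<gamma> (x$1) = x$2 *\<^sub>R tang_at a - y$2 *\<^sub>R tang_at b"
    using eq by (simp add: sweep_def a_def b_def algebra_simps)
  have s1: "tang_at b \<bullet> unit_at a = sin (a - b)" and s2: "tang_at a \<bullet> unit_at b = - sin (a - b)"
    by (simp_all add: inner_real2 sin_diff algebra_simps)
  have d1: "(\<gamma> (y$1) - \<gamma> (x$1)) \<bullet> unit_at a = - y$2 * sin (a - b)"
    unfolding e by (simp add: inner_diff_left s1)
  have d2: "(\<gamma> (x$1) - \<gamma> (y$1)) \<bullet> unit_at b = x$2 * sin (a - b)"
  proof -
    have "\<gamma> (x$1) - \<gamma> (y$1) = y$2 *\<^sub>R tang_at b - x$2 *\<^sub>R tang_at a" using e by (metis minus_diff_eq)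
    then show ?thesis by (simp add: inner_diff_left s2)
  qed
  have "- y$2 * sin (a - b) \<le> 0" using supporting[OF on_K, of "y$1" "x$1"] d1 by (simp add: a_def)
  moreover have "x$2 * sin (a - b) \<le> 0" using supporting[OF on_K, of "x$1" "y$1"] d2 by (simp add: b_def)
  ultimately have "sin (a - b) = 0" using x y by (auto simp: sweep_domain_def mult_le_0_iff zero_le_mult_iff)
  then have "\<gamma> (y$1) = \<gamma> (x$1)"
    using contact_point_unique[OF on_K, of "y$1" "x$1"] d1 x by (simp add: sweep_domain_def a_def)
  then have xy: "y$1 = x$1" using curve_inj[of "y$1" "x$1"] x y by (simp add: sweep_domain_def)
  then have "x$2 *\<^sub>R tang_at a = y$2 *\<^sub>R tang_at a" using e by (simp add: a_def b_def)
  moreover have "tang_at a \<noteq> 0" using norm_tang_at[of a] by (metis norm_zero zero_neq_one)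
  ultimately have "x$2 = y$2" by simp
  then show "x = y" using xy by (simp add: vec_eq_real2)
qed

definition sweep' :: "real^2 \<Rightarrow> real^2 \<Rightarrow> real^2" where
  "sweep' x h = h$1 *\<^sub>R (\<sigma> (x$1) *\<^sub>R tang_at (\<nu> (x$1)) - (x$2 * \<nu>' (x$1)) *\<^sub>R unit_at (\<nu> (x$1))) + h$2 *\<^sub>R tang_at (\<nu> (x$1))"

lemma sweep_derivative: "(sweep has_derivative sweep' x) (at x within S)"
proof -
  have 1: "((\<lambda>x. x$1) has_derivative (\<lambda>h. h$1)) (at x within S)"
    and 2: "((\<lambda>x. x$2) has_derivative (\<lambda>h. h$2)) (at x within S)" for x :: "real^2"
    by (intro bounded_linear_imp_has_derivative bounded_linear_vec_nth)+
  have g: "((\<lambda>x. \<gamma> (x$1)) has_derivative (\<lambda>h. h$1 *\<^sub>R (\<sigma> (x$1) *\<^sub>R tang_at (\<nu> (x$1))))) (at x within S)"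
    by (rule has_derivative_compose[OF 1 \<gamma>_deriv[unfolded has_vector_derivative_def]])
  have t: "((\<lambda>x. tang_at (\<nu> (x$1))) has_derivative (\<lambda>h. h$1 *\<^sub>R (- \<nu>' (x$1) *\<^sub>R unit_at (\<nu> (x$1))))) (at x within S)"
    by (rule has_derivative_compose[OF 1 unit_at_comp_derivative(2)[OF \<nu>_deriv, unfolded has_vector_derivative_def]])
  show ?thesis
    unfolding sweep_def[abs_def]
    by (rule has_derivative_eq_rhs[OF has_derivative_add[OF g has_derivative_scaleR[OF 2 t]]])
      (simp add: sweep'_def[abs_def] fun_eq_iff algebra_simps)
qed

text \<open>Hence the area element is \<open>r dr d\<nu>\<close>.\<close>

lemma det_sweep': "det (matrix (sweep' x)) = - (x$2 * \<nu>' (x$1))"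
proof -
  have "det (matrix (sweep' x)) = - (x$2 * \<nu>' (x$1)) * ((sin (\<nu> (x$1)))\<^sup>2 + (cos (\<nu> (x$1)))\<^sup>2)"
    unfolding det_2 matrix_def sweep'_def axis_def by (simp add: power2_eq_square) algebra
  then show ?thesis by simp
qed

text \<open>An exterior point outside the image of \<open>sweep_domain\<close> lies on a half-tangent at a parameter where
  \<open>\<nu>'\<close> vanishes, hence is a critical value of the sweep.\<close>

lemma negligible_not_swept: "negligible (- K - sweep ` sweep_domain)"
proof -
  let ?Z = "{x. det (matrix (sweep' x)) = 0}"
  have "negligible (sweep ` ?Z)"
    by (rule baby_Sard[where f' = sweep']) (auto simp: sweep_derivative det_eq_0_rank)
  moreover have "- K - sweep ` sweep_domain \<subseteq> sweep ` ?Z"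
  proof
    fix P assume P: "P \<in> - K - sweep ` sweep_domain"
    then obtain x where x: "P = sweep x" "0 \<le> x$1" "x$1 < 1" "0 < x$2" using exterior_covered by auto
    with P have "\<not> 0 < \<nu>' (x$1)" by (auto simp: sweep_domain_def)
    then have "\<nu>' (x$1) = 0" using angular_speed_nonneg[of "x$1"] by simp
    then show "P \<in> sweep ` ?Z" using x(1) by (auto simp: det_sweep')
  qed
  ultimately show ?thesis by (rule negligible_subset)
qed

lemma sweep_domain_borel [measurable]: "sweep_domain \<in> sets borel"
proof -
  have [measurable]: "\<nu>' \<in> borel_measurable borel" using \<nu>'_cont by (rule borel_measurable_continuous_onI)
  have [measurable]: "(\<lambda>x::real^2. x $ i) \<in> borel_measurable borel" for i
    by (intro borel_measurable_continuous_onI continuous_intros)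
  show ?thesis unfolding sweep_domain_def by measurable
qed

lemma sweep_change_of_variables:
  fixes f :: "real^2 \<Rightarrow> real"
  assumes f: "set_borel_measurable borel (- K) f"
    and int: "set_integrable lborel sweep_domain (\<lambda>x. x$2 * \<nu>' (x$1) * f (sweep x))"
  shows "set_integrable lborel (- K) f"
    and "(LINT P : - K | lborel. f P) = (LINT x : sweep_domain | lborel. x$2 * \<nu>' (x$1) * f (sweep x))"
proof -
  let ?j = "\<lambda>x. x$2 * \<nu>' (x$1) * f (sweep x)"
  let ?V = "\<lambda>x. (vec (f x) :: real^1)"
  define I where "I = (LINT x : sweep_domain | lborel. ?j x)"
  have leb: "set_integrable lebesgue sweep_domain ?j"
    using int unfolding set_integrable_def by (subst integrable_completion) (auto dest: borel_measurable_integrable)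
  have j: "\<bar>det (matrix (sweep' x))\<bar> *\<^sub>R ?V (sweep x) $ 1 = ?j x" if "x \<in> sweep_domain" for x
    using that by (simp add: det_sweep' sweep_domain_def)
  have ai: "(\<lambda>x. (\<bar>det (matrix (sweep' x))\<bar> *\<^sub>R ?V (sweep x)) $ 1) absolutely_integrable_on sweep_domain"
  proof -
    have "(\<lambda>x. (\<bar>det (matrix (sweep' x))\<bar> *\<^sub>R ?V (sweep x)) $ 1) absolutely_integrable_on sweep_domain
      \<longleftrightarrow> set_integrable lebesgue sweep_domain ?j"
      by (rule set_integrable_cong) (use j in auto)
    with leb show ?thesis by blast
  qed
  have ei: "integral sweep_domain (\<lambda>x. (\<bar>det (matrix (sweep' x))\<bar> *\<^sub>R ?V (sweep x)) $ 1) = I"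
    unfolding I_def set_borel_integral_eq_integral(2)[OF int]
    by (rule Henstock_Kurzweil_Integration.integral_cong) (use j in simp)
  have "?V absolutely_integrable_on (sweep ` sweep_domain) \<and> integral (sweep ` sweep_domain) ?V = vec I"
    using has_absolute_integral_change_of_variables[OF _ sweep_derivative sweep_inj, of ?V "vec I"] ai ei sweep_domain_borel
    by (simp add: absolutely_integrable_on_1_iff integral_on_1_eq)
  then have im: "f absolutely_integrable_on (sweep ` sweep_domain)" "integral (sweep ` sweep_domain) f = I"
    by (auto simp: absolutely_integrable_on_1_iff integral_on_1_eq vec_eq_iff)
  have sub: "sweep ` sweep_domain - - K = {}" using sweep_outside by (auto simp: sweep_domain_def)
  have n1: "negligible {x \<in> sweep ` sweep_domain - - K. f x \<noteq> 0}" unfolding sub by simp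
  have n2: "negligible {x \<in> - K - sweep ` sweep_domain. f x \<noteq> 0}"
    by (rule negligible_subset[OF negligible_not_swept]) auto
  have aiK: "f absolutely_integrable_on - K"
    using absolutely_integrable_spike_set[OF im(1) n1 n2] .
  show si: "set_integrable lborel (- K) f"
    using aiK f unfolding set_integrable_def set_borel_measurable_def
    by (subst (asm) integrable_completion) auto
  show "(LINT P : - K | lborel. f P) = (LINT x : sweep_domain | lborel. ?j x)"
    unfolding set_borel_integral_eq_integral(2)[OF si] I_def[symmetric] im(2)[symmetric]
    by (rule integral_spike_set[OF n2 n1])
qed

end

section \<open>The exterior integral\<close>

lemma vector_pair_measurable [measurable]:
  "(\<lambda>z::real \<times> real. vector [fst z, snd z] :: real^2) \<in> borel_measurable borel"
proof -
  have vec: "(\<lambda>z::real \<times> real. vector [fst z, snd z] :: real^2) = (\<lambda>z. \<chi> i. if i = 1 then fst z else snd z)"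
    by (simp add: fun_eq_iff vec_eq_real2)
  have "continuous_on UNIV (\<lambda>z::real \<times> real. if i = 1 then fst z else snd z)" for i :: 2
    by (cases "i = 1") (auto intro!: continuous_intros)
  then show ?thesis unfolding vec by (intro borel_measurable_continuous_onI continuous_intros)
qed

lemma lborel_real2: "(lborel :: (real^2) measure) = distr (lborel :: (real \<times> real) measure) borel (\<lambda>z. vector [fst z, snd z])"
proof (rule lborel_eqI)
  have m: "(\<lambda>z::real \<times> real. vector [fst z, snd z] :: real^2) \<in> measurable lborel borel"
    by simp
  fix l u :: "real^2" assume lu: "\<And>b. b \<in> Basis \<Longrightarrow> l \<bullet> b \<le> u \<bullet> b"
  have ax: "axis i (1::real) \<in> (Basis :: (real^2) set)" for i by (auto simp: Basis_vec_def)
  have le: "l$1 \<le> u$1" "l$2 \<le> u$2" using lu[OF ax[of 1]] lu[OF ax[of 2]] by (auto simp: inner_axis)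
  have pre: "(\<lambda>z::real \<times> real. vector [fst z, snd z]) -` box l u \<inter> space lborel = box (l$1, l$2) (u$1, u$2)"
    by (auto simp: mem_box_cart forall_2 mem_box Basis_prod_def)
  have B: "(Basis :: (real^2) set) = {axis 1 1, axis 2 1}"
    by (auto simp: Basis_vec_def UNIV_2)
  have "(\<Prod>b\<in>Basis. (u - l) \<bullet> b) = (u$1 - l$1) * (u$2 - l$2)"
    unfolding B by (simp add: inner_axis axis_eq_axis)
  moreover have "(\<Prod>b\<in>Basis. ((u$1, u$2) - (l$1, l$2)) \<bullet> b) = (u$1 - l$1) * (u$2 - l$2)"
    by (simp add: Basis_prod_def)
  moreover have "emeasure lborel (box (l$1, l$2) (u$1, u$2)) = (\<Prod>b\<in>Basis. ((u$1, u$2) - (l$1, l$2)) \<bullet> b)"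
    using le by (intro emeasure_lborel_box) (auto simp: Basis_prod_def)
  ultimately show "emeasure (distr lborel borel (\<lambda>z::real \<times> real. vector [fst z, snd z])) (box l u) = (\<Prod>b\<in>Basis. (u - l) \<bullet> b)"
    by (subst emeasure_distr[OF m]) (simp_all add: pre[simplified])
qed simp

lemma vec_nth_measurable [measurable]: "(\<lambda>x::real^2. x $ i) \<in> borel_measurable borel"
  by (intro borel_measurable_continuous_onI continuous_intros)

lemma nn_integral_real2:
  assumes [measurable]: "f \<in> borel_measurable (borel :: (real^2) measure)"
  shows "(\<integral>\<^sup>+x. f x \<partial>lborel) = (\<integral>\<^sup>+a. (\<integral>\<^sup>+b. f (vector [a, b]) \<partial>lborel) \<partial>lborel)"
proof -
  have "(\<integral>\<^sup>+x. f x \<partial>lborel) = (\<integral>\<^sup>+z. f (vector [fst z, snd z]) \<partial>(lborel :: (real \<times> real) measure))"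
    by (subst lborel_real2, subst nn_integral_distr) simp_all
  also have "\<dots> = (\<integral>\<^sup>+z. f (vector [fst z, snd z]) \<partial>((lborel :: real measure) \<Otimes>\<^sub>M (lborel :: real measure)))"
    by (simp add: lborel_prod)
  also have "\<dots> = (\<integral>\<^sup>+a. (\<integral>\<^sup>+b. f (vector [a, b]) \<partial>lborel) \<partial>lborel)"
    by (subst lborel.nn_integral_fst[symmetric]) (simp_all add: lborel_prod)
  finally show ?thesis .
qed

context convex_oval
begin

lemma \<nu>'_measurable [measurable]: "\<nu>' \<in> borel_measurable borel"
  using \<nu>'_cont by (rule borel_measurable_continuous_onI)

lemma continuous_on_\<nu>': "continuous_on S \<nu>'"
  using \<nu>'_cont continuous_on_subset by blast

text \<open>Integration over \<open>r\<close> from 0 to \<open>\<rho> t\<close> gives half the square of \<open>\<rho> t\<close>.\<close>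

lemma sweep_domain_sector_integral:
  assumes \<rho>: "continuous_on UNIV \<rho>" "\<And>t. 0 \<le> \<rho> t"
  shows "has_bochner_integral lborel
    (\<lambda>x. indicator sweep_domain x * indicator {x. x$2 \<le> \<rho> (x$1)} x * (x$2 * \<nu>' (x$1)))
    (integral {0..1} (\<lambda>t. \<nu>' t * (\<rho> t)\<^sup>2 / 2))"
proof (rule has_bochner_integral_nn_integral)
  have [measurable]: "\<rho> \<in> borel_measurable borel" using \<rho>(1) by (rule borel_measurable_continuous_onI)
  let ?f = "\<lambda>x. indicator sweep_domain x * indicator {x. x$2 \<le> \<rho> (x$1)} x * (x$2 * \<nu>' (x$1))"
  let ?g = "\<lambda>t. \<nu>' t * (\<rho> t)\<^sup>2 / 2"
  have fm: "?f \<in> borel_measurable borel" by measurable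
  then show "?f \<in> borel_measurable lborel" by simp
  show "AE x in lborel. 0 \<le> ?f x"
    by (rule AE_I2) (auto simp: sweep_domain_def indicator_def)
  have cg: "continuous_on {0..1} ?g"
    by (intro continuous_intros continuous_on_\<nu>' continuous_on_subset[OF \<rho>(1)]) auto
  have g0: "0 \<le> ?g t" for t using angular_speed_nonneg by simp
  show "0 \<le> integral {0..1} ?g" using g0 by (intro integral_nonneg integrable_continuous_real cg) auto
  have inner: "(\<integral>\<^sup>+b. ennreal (?f (vector [a, b])) \<partial>lborel) = ennreal (?g a) * indicator {0..<1} a" for a
  proof (cases "0 \<le> a \<and> a < 1")
    case True
    have "(\<integral>\<^sup>+b. ennreal (?f (vector [a, b])) \<partial>lborel) = (\<integral>\<^sup>+b. ennreal (b * \<nu>' a) * indicator {0..\<rho> a} b \<partial>lborel)"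
      using True angular_speed_nonneg[of a]
      by (intro nn_integral_cong) (auto simp: sweep_domain_def indicator_def)
    also have "\<dots> = ennreal (?g a - 0\<^sup>2 * \<nu>' a / 2)"
    proof (rule trans[OF nn_integral_FTC_Icc[where F = "\<lambda>b. b\<^sup>2 * \<nu>' a / 2"]])
      show "((\<lambda>b. b\<^sup>2 * \<nu>' a / 2) has_real_derivative b * \<nu>' a) (at b)" for b
        by (auto intro!: derivative_eq_intros)
    qed (use angular_speed_nonneg \<rho>(2) in \<open>auto simp: mult.commute\<close>)
    finally show ?thesis using True by simp
  next
    case False
    then have "(\<integral>\<^sup>+b. ennreal (?f (vector [a, b])) \<partial>lborel) = (\<integral>\<^sup>+b. 0 \<partial>(lborel :: real measure))"
      by (intro nn_integral_cong) (auto simp: sweep_domain_def)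
    then show ?thesis using False by (auto simp: indicator_def)
  qed
  have "(\<integral>\<^sup>+x. ennreal (?f x) \<partial>lborel) = (\<integral>\<^sup>+a. (\<integral>\<^sup>+b. ennreal (?f (vector [a, b])) \<partial>lborel) \<partial>lborel)"
    using fm by (intro nn_integral_real2 measurable_compose[OF _ measurable_ennreal])
  also have "\<dots> = (\<integral>\<^sup>+a. ennreal (?g a) * indicator {0..<1} a \<partial>lborel)"
    unfolding inner ..
  also have "\<dots> = (\<integral>\<^sup>+a. ennreal (?g a) * indicator {0..1} a \<partial>lborel)"
    by (intro nn_integral_cong_AE eventually_mono[OF AE_lborel_singleton[of 1]]) (auto simp: indicator_def)
  also have "\<dots> = ennreal (integral {0..1} ?g)"
    using g0 by (intro nn_integral_has_integral_lebesgue' integrable_integral integrable_continuous_real cg) auto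
  finally show "(\<integral>\<^sup>+x. ennreal (?f x) \<partial>lborel) = ennreal (integral {0..1} ?g)" .
qed

text \<open>The distance from \<open>\<gamma> t\<close> to the supporting line of \<open>K\<close> whose outer normal is turned by \<open>\<theta>\<close>
  from the normal at \<open>\<gamma> t\<close>.\<close>

definition gap :: "real \<Rightarrow> real \<Rightarrow> real" where
  "gap t \<theta> = support_fun K (\<nu> t + \<theta>) - \<gamma> t \<bullet> unit_at (\<nu> t + \<theta>)"

lemma gap_nonneg: "0 \<le> gap t \<theta>"
  using support_fun_ge[OF K(1) on_K] by (simp add: gap_def)

lemma continuous_on_\<gamma>: "continuous_on S \<gamma>"
  using \<gamma>_deriv has_vector_derivative_at_within by (intro continuous_on_vector_derivative) blast

lemma continuous_on_gap:
  assumes "continuous_on S f" "continuous_on S g" shows "continuous_on S (\<lambda>x. gap (f x) (g x))"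
  unfolding gap_def
  by (intro continuous_intros assms continuous_on_compose2[OF continuous_on_support_fun[OF K(1) K_nonempty, of UNIV]]
      continuous_on_compose2[OF continuous_on_unit_at[of UNIV]] continuous_on_compose2[OF continuous_on_\<gamma>[of UNIV]]
      continuous_on_compose2[OF continuous_on_\<nu>[of UNIV]]) auto

definition mean_square_gap :: "real \<Rightarrow> real" where
  "mean_square_gap \<theta> = integral {0..1} (\<lambda>t. \<nu>' t * (gap t \<theta>)\<^sup>2)"

lemma continuous_on_mean_square_gap: "continuous_on S mean_square_gap"
proof -
  have "continuous_on UNIV (\<lambda>\<theta>. integral (cbox 0 1) (\<lambda>t. \<nu>' t * (gap t \<theta>)\<^sup>2))"
    by (intro integral_continuous_on_param)
      (auto simp: split_beta intro!: continuous_intros continuous_on_gap continuous_on_compose2[OF \<nu>'_cont])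
  then show ?thesis unfolding mean_square_gap_def[abs_def] by (auto intro: continuous_on_subset)
qed

lemma mean_square_gap_nonneg: "0 \<le> mean_square_gap \<theta>"
  unfolding mean_square_gap_def
  by (intro integral_nonneg integrable_continuous_real continuous_intros continuous_on_gap continuous_on_\<nu>')
    (simp add: angular_speed_nonneg)

text \<open>The integrand on pairs \<open>(\<theta>, x)\<close>. Integrating it over \<open>\<theta>\<close> restores \<open>sin\<^sup>m \<omega>\<close> at the
  point \<open>sweep x\<close> times the Jacobian (\<open>layer_fibre\<close>); integrating it over \<open>x\<close> first involves only
  polynomial expressions in the gap (\<open>layer_section\<close>).\<close>

definition layer :: "nat \<Rightarrow> real \<Rightarrow> real^2 \<Rightarrow> real" where
  "layer m \<theta> x = indicator {0<..<pi} \<theta> * (- real m * sin \<theta> ^ (m - 1) * cos \<theta>) *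
     (indicator sweep_domain x * indicator {x. x$2 \<le> gap (x$1) \<theta> / sin \<theta>} x * (x$2 * \<nu>' (x$1)))"

lemma layer_measurable:
  "(\<lambda>z. layer m (fst z) (snd z)) \<in> borel_measurable (lborel \<Otimes>\<^sub>M lborel)"
proof -
  have c: "(\<lambda>z::real \<times> (real^2). gap (snd z $ 1) (fst z)) \<in> borel_measurable borel"
    by (intro borel_measurable_continuous_onI continuous_on_gap continuous_intros)
  have f: "(\<lambda>z::real \<times> (real^2). fst z) \<in> borel_measurable borel"
    and s: "(\<lambda>z::real \<times> (real^2). snd z $ i) \<in> borel_measurable borel" for i
    by (intro borel_measurable_continuous_onI continuous_intros)+
  note [measurable] = c f s
  have "(\<lambda>z. layer m (fst z) (snd z)) =
    (\<lambda>z::real \<times> (real^2). if 0 < fst z \<and> fst z < pi \<and> 0 \<le> snd z $ 1 \<and> snd z $ 1 < 1 \<and> 0 < snd z $ 2 \<and> 0 < \<nu>' (snd z $ 1)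
        \<and> snd z $ 2 \<le> gap (snd z $ 1) (fst z) / sin (fst z)
      then (- real m * sin (fst z) ^ (m - 1) * cos (fst z)) * (snd z $ 2 * \<nu>' (snd z $ 1)) else 0)"
    by (auto simp: layer_def sweep_domain_def indicator_def fun_eq_iff)
  also have "\<dots> \<in> borel_measurable borel" by measurable
  finally show ?thesis by (simp add: lborel_prod)
qed

lemma layer_section:
  assumes m: "m \<ge> 3"
  shows "has_bochner_integral lborel (layer m \<theta>)
     (indicator {0<..<pi} \<theta> * (- (real m / 2) * sin \<theta> ^ (m - 3) * cos \<theta> * mean_square_gap \<theta>))"
    and "has_bochner_integral lborel (\<lambda>x. norm (layer m \<theta> x))
     (indicator {0<..<pi} \<theta> * \<bar>- (real m / 2) * sin \<theta> ^ (m - 3) * cos \<theta> * mean_square_gap \<theta>\<bar>)"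
proof -
  have "has_bochner_integral lborel (layer m \<theta>)
     (indicator {0<..<pi} \<theta> * (- (real m / 2) * sin \<theta> ^ (m - 3) * cos \<theta> * mean_square_gap \<theta>)) \<and>
    has_bochner_integral lborel (\<lambda>x. norm (layer m \<theta> x))
     (indicator {0<..<pi} \<theta> * \<bar>- (real m / 2) * sin \<theta> ^ (m - 3) * cos \<theta> * mean_square_gap \<theta>\<bar>)"
  proof (cases "\<theta> \<in> {0<..<pi}")
    case False
    then have "layer m \<theta> = (\<lambda>x. 0)" by (simp add: layer_def fun_eq_iff)
    with False show ?thesis by (auto intro: has_bochner_integral_zero)
  next
    case True
    then have s: "0 < sin \<theta>" by (simp add: sin_gt_zero)
    let ?e = "- real m * sin \<theta> ^ (m - 1) * cos \<theta>"
    let ?b = "\<lambda>x. indicator sweep_domain x * indicator {x. x$2 \<le> gap (x$1) \<theta> / sin \<theta>} x * (x$2 * \<nu>' (x$1))"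
    let ?I = "integral {0..1} (\<lambda>t. \<nu>' t * (gap t \<theta> / sin \<theta>)\<^sup>2 / 2)"
    have b: "has_bochner_integral lborel ?b ?I"
      using s gap_nonneg by (intro sweep_domain_sector_integral continuous_intros continuous_on_gap) auto
    have I: "?I = mean_square_gap \<theta> / (2 * (sin \<theta>)\<^sup>2)"
    proof -
      have "?I = integral {0..1} (\<lambda>t. (1 / (2 * (sin \<theta>)\<^sup>2)) * (\<nu>' t * (gap t \<theta>)\<^sup>2))"
        by (intro Henstock_Kurzweil_Integration.integral_cong) (simp add: power_divide)
      then show ?thesis by (simp add: mean_square_gap_def)
    qed
    have "m - 1 = (m - 3) + 2" using m by simp
    then have p: "sin \<theta> ^ (m - 1) = sin \<theta> ^ (m - 3) * (sin \<theta>)\<^sup>2" by (metis power_add)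
    have v: "?e * ?I = - (real m / 2) * sin \<theta> ^ (m - 3) * cos \<theta> * mean_square_gap \<theta>"
      unfolding I p using s by simp
    have l: "layer m \<theta> x = ?e * ?b x" for x using True by (simp add: layer_def)
    have "\<bar>?b x\<bar> = ?b x" for x by (simp add: sweep_domain_def indicator_def)
    then have n: "norm (layer m \<theta> x) = \<bar>?e\<bar> * ?b x" for x
      unfolding l real_norm_def abs_mult[of ?e "?b x"] by simp
    have I0: "\<bar>?I\<bar> = ?I" unfolding I using mean_square_gap_nonneg by simp
    have h1: "has_bochner_integral lborel (\<lambda>x. ?e * ?b x) (?e * ?I)"
      by (intro has_bochner_integral_mult_right b)
    have h2: "has_bochner_integral lborel (\<lambda>x. \<bar>?e\<bar> * ?b x) (\<bar>?e\<bar> * ?I)"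
      by (intro has_bochner_integral_mult_right b)
    have h3: "\<bar>?e\<bar> * ?I = \<bar>?e * ?I\<bar>" unfolding abs_mult[of ?e ?I] I0 ..
    have h4: "layer m \<theta> = (\<lambda>x. ?e * ?b x)" using l by (rule ext)
    have ind: "indicator {0<..<pi} \<theta> = (1::real)" using True by simp
    show ?thesis
      unfolding n unfolding h4 ind mult_1 using h1 h2 unfolding h3 v by blast
  qed
  then show "has_bochner_integral lborel (layer m \<theta>)
     (indicator {0<..<pi} \<theta> * (- (real m / 2) * sin \<theta> ^ (m - 3) * cos \<theta> * mean_square_gap \<theta>))"
    and "has_bochner_integral lborel (\<lambda>x. norm (layer m \<theta> x))
     (indicator {0<..<pi} \<theta> * \<bar>- (real m / 2) * sin \<theta> ^ (m - 3) * cos \<theta> * mean_square_gap \<theta>\<bar>)" by blast+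
qed

text \<open>The condition on \<open>x\<close> in the layer says \<open>\<theta> \<ge> \<pi> - \<omega>\<close>, and \<open>- sin\<^sup>m\<close> is an antiderivative
  of the weight, with value 0 at \<open>\<pi>\<close> and \<open>- sin\<^sup>m \<omega>\<close> at \<open>\<pi> - \<omega>\<close>.\<close>

lemma layer_fibre:
  assumes m: "m \<ge> 3"
  shows "(LINT \<theta> | lborel. layer m \<theta> x) = indicator sweep_domain x * (x$2 * \<nu>' (x$1) * sin (visual_angle K (sweep x)) ^ m)"
proof (cases "x \<in> sweep_domain")
  case False
  then show ?thesis by (simp add: layer_def)
next
  case True
  then have x: "0 < x$2" "0 < \<nu>' (x$1)" by (auto simp: sweep_domain_def)
  define P where "P = sweep x"
  interpret ext: exterior_point K P
    using K interior_nonempty sweep_outside[OF x] unfolding P_def by unfold_locales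
  define w where "w = visual_angle K P"
  have w: "0 \<le> w" "w \<le> pi" using ext.visual_angle_range by (auto simp: w_def)
  let ?c = "x$2 * \<nu>' (x$1)"
  let ?e = "\<lambda>\<theta>. - real m * sin \<theta> ^ (m - 1) * cos \<theta>"
  have iff: "x$2 \<le> gap (x$1) \<theta> / sin \<theta> \<longleftrightarrow> pi - w \<le> \<theta>" if th: "0 < \<theta>" "\<theta> < pi" for \<theta>
  proof -
    have "P \<bullet> unit_at (\<nu> (x$1) + \<theta>) \<le> support_fun K (\<nu> (x$1) + \<theta>) \<longleftrightarrow> pi - w \<le> \<theta>"
      unfolding w_def
      by (rule ext.visible_iff_tangent_angle[where X = "\<gamma> (x$1)" and r = "x$2"])
        (use th x supporting on_K in \<open>auto simp: P_def sweep_def\<close>)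
    moreover have "tang_at n \<bullet> unit_at (n + \<theta>) = sin \<theta>" for n
    proof -
      have "tang_at n \<bullet> unit_at (n + \<theta>) = sin \<theta> * ((sin n)\<^sup>2 + (cos n)\<^sup>2)"
        unfolding inner_real2 tang_at_nth unit_at_nth cos_add sin_add by algebra
      then show ?thesis by simp
    qed
    then have "P \<bullet> unit_at (\<nu> (x$1) + \<theta>) = \<gamma> (x$1) \<bullet> unit_at (\<nu> (x$1) + \<theta>) + x$2 * sin \<theta>"
      by (simp add: P_def sweep_def inner_add_left)
    moreover have "x$2 \<le> gap (x$1) \<theta> / sin \<theta> \<longleftrightarrow> x$2 * sin \<theta> \<le> gap (x$1) \<theta>"
      using sin_gt_zero[OF th] by (rule pos_le_divide_eq)
    ultimately show ?thesis unfolding gap_def by linarith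
  qed
  have "(LINT \<theta> | lborel. layer m \<theta> x) = (LINT \<theta> | lborel. ?c * (?e \<theta> * indicator {pi - w..pi} \<theta>))"
  proof (rule integral_cong_AE)
    show "AE \<theta> in lborel. layer m \<theta> x = ?c * (?e \<theta> * indicator {pi - w..pi} \<theta>)"
      using AE_lborel_singleton[of 0] AE_lborel_singleton[of pi]
    proof eventually_elim
      case (elim \<theta>)
      then show ?case
        using iff[of \<theta>] w True by (cases "0 < \<theta> \<and> \<theta> < pi") (auto simp: layer_def indicator_def)
    qed
    have "(\<lambda>\<theta>. layer m \<theta> x) = (\<lambda>\<theta>. layer m (fst (\<theta>, x)) (snd (\<theta>, x)))" by simp
    also have "\<dots> \<in> borel_measurable lborel"
      by (rule measurable_compose[OF _ layer_measurable]) simp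
    finally show "(\<lambda>\<theta>. layer m \<theta> x) \<in> borel_measurable lborel" .
  qed measurable
  also have "\<dots> = ?c * (LINT \<theta> | lborel. ?e \<theta> * indicator {pi - w..pi} \<theta>)" by simp
  also have "(LINT \<theta> | lborel. ?e \<theta> * indicator {pi - w..pi} \<theta>) = - (sin pi ^ m) - - (sin (pi - w) ^ m)"
  proof (rule integral_FTC_Icc_real)
    show "((\<lambda>\<theta>. - (sin \<theta> ^ m)) has_real_derivative ?e \<theta>) (at \<theta>)" for \<theta>
      by (auto intro!: derivative_eq_intros)
    show "isCont ?e \<theta>" for \<theta> by (intro continuous_intros)
  qed (use w in simp)
  also have "\<dots> = sin w ^ m" using m by (simp add: power_0_left)
  finally show ?thesis using True by (simp add: w_def P_def)
qed

text \<open>The layers are integrated in both orders; the sweep identifies one of the two iterated integrals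
  with the integral over the exterior.\<close>

lemma exterior_integral_eq:
  assumes m: "m \<ge> 3"
  shows "set_integrable lborel (- K) (\<lambda>P. sin (visual_angle K P) ^ m)"
    and "(LINT P : - K | lborel. sin (visual_angle K P) ^ m)
       = - (real m / 2) * integral {0..pi} (\<lambda>\<theta>. sin \<theta> ^ (m - 3) * cos \<theta> * mean_square_gap \<theta>)"
proof -
  let ?L = "\<lambda>\<theta>. - (real m / 2) * sin \<theta> ^ (m - 3) * cos \<theta> * mean_square_gap \<theta>"
  have cL: "continuous_on S ?L" for S by (intro continuous_intros continuous_on_mean_square_gap)
  have siL: "set_integrable lborel {0<..<pi} ?L"
    by (rule set_integrable_subset[OF borel_integrable_atLeastAtMost'[OF cL[of "{0..pi}"]]]) auto
  have int: "integrable (lborel \<Otimes>\<^sub>M lborel) (\<lambda>z. layer m (fst z) (snd z))"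
  proof (rule lborel_pair.Fubini_integrable[OF layer_measurable])
    have "(\<lambda>\<theta>. LINT x | lborel. norm (layer m \<theta> x)) = (\<lambda>\<theta>. norm (indicator {0<..<pi} \<theta> *\<^sub>R ?L \<theta>))"
      using has_bochner_integral_integral_eq[OF layer_section(2)[OF m]] by (simp add: fun_eq_iff abs_mult)
    then show "integrable lborel (\<lambda>\<theta>. LINT x | lborel. norm (layer m (fst (\<theta>, x)) (snd (\<theta>, x))))"
      using siL unfolding set_integrable_def by (simp only: fst_conv snd_conv integrable_norm)
    show "AE \<theta> in lborel. integrable lborel (\<lambda>x. layer m (fst (\<theta>, x)) (snd (\<theta>, x)))"
      using layer_section(1)[OF m] by (intro AE_I2) (auto simp: has_bochner_integral_iff)
  qed
  let ?v = "\<lambda>P. sin (visual_angle K P) ^ m"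
  let ?j = "\<lambda>x. indicator sweep_domain x *\<^sub>R (x$2 * \<nu>' (x$1) * ?v (sweep x))"
  have int': "integrable (lborel \<Otimes>\<^sub>M lborel) (\<lambda>(\<theta>, x). layer m \<theta> x)" using int by (simp add: case_prod_beta')
  have "integrable lborel ?j"
    using lborel_pair.integrable_snd[OF int'] by (simp add: layer_fibre[OF m])
  then have si: "set_integrable lborel sweep_domain (\<lambda>x. x$2 * \<nu>' (x$1) * ?v (sweep x))"
    unfolding set_integrable_def .
  note cov = sweep_change_of_variables[OF sin_visual_angle_measurable[OF K(1,2) interior_nonempty] si]
  show "set_integrable lborel (- K) ?v" by (rule cov(1))
  have "(LINT P : - K | lborel. ?v P) = (LINT x : sweep_domain | lborel. x$2 * \<nu>' (x$1) * ?v (sweep x))"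
    by (rule cov(2))
  also have "\<dots> = (LINT x | lborel. LINT \<theta> | lborel. layer m \<theta> x)"
    unfolding set_lebesgue_integral_def by (simp add: layer_fibre[OF m])
  also have "\<dots> = (LINT \<theta> | lborel. LINT x | lborel. layer m \<theta> x)"
    by (rule lborel_pair.Fubini_integral[OF int'])
  also have "\<dots> = (LINT \<theta> : {0<..<pi} | lborel. ?L \<theta>)"
    unfolding has_bochner_integral_integral_eq[OF layer_section(1)[OF m]] set_lebesgue_integral_def by simp
  also have "\<dots> = integral {0..pi} ?L"
    unfolding set_borel_integral_eq_integral(2)[OF siL] by (rule integral_open_interval_real[symmetric])
  also have "\<dots> = integral {0..pi} (\<lambda>\<theta>. - (real m / 2) * (sin \<theta> ^ (m - 3) * cos \<theta> * mean_square_gap \<theta>))"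
    by (simp add: mult.assoc)
  finally show "(LINT P : - K | lborel. ?v P) = - (real m / 2) * integral {0..pi} (\<lambda>\<theta>. sin \<theta> ^ (m - 3) * cos \<theta> * mean_square_gap \<theta>)"
    by simp
qed

end

section \<open>Periodic functions and autocorrelation\<close>

lemma integral_FTC_real:
  fixes F f :: "real \<Rightarrow> real"
  assumes "a \<le> b" "\<And>x. (F has_real_derivative f x) (at x)"
  shows "integral {a..b} f = F b - F a"
proof (rule integral_unique, rule fundamental_theorem_of_calculus[OF assms(1)])
  show "(F has_vector_derivative f x) (at x within {a..b})" for x
    using assms(2)[of x] unfolding has_real_derivative_iff_has_vector_derivative
    by (rule has_vector_derivative_at_within)
qed

lemma integral_periodic:
  fixes f :: "real \<Rightarrow> real"
  assumes c: "continuous_on UNIV f" and T: "0 \<le> T" "\<And>x. f (x + T) = f x"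
  shows "integral {a..a + T} f = integral {0..T} f"
proof -
  obtain F where F: "\<And>x. (F has_real_derivative f x) (at x)" using antiderivative_exists[OF c] by blast
  have FT: "((\<lambda>x. F (x + T)) has_real_derivative f x) (at x)" for x
    using F[of "x + T"] unfolding DERIV_shift T(2) .
  have "((\<lambda>x. F (x + T) - F x) has_real_derivative (f x - f x)) (at x)" for x
    by (rule DERIV_diff[OF FT F])
  then have "F (a + T) - F a = F (0 + T) - F 0"
    by (intro DERIV_isconst_all[of "\<lambda>x. F (x + T) - F x"]) simp
  then show ?thesis
    using integral_FTC_real[OF _ F, of a "a + T"] integral_FTC_real[OF _ F, of 0 T] T(1) by simp
qed

lemma integral_shift_period:
  fixes f :: "real \<Rightarrow> real"
  assumes c: "continuous_on UNIV f" and T: "0 \<le> T" "\<And>x. f (x + T) = f x"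
  shows "integral {0..T} (\<lambda>x. f (x + a)) = integral {0..T} f"
  using integral_shift_real_ivl[of a a "a + T" f] integral_periodic[OF c T, of a] by simp

lemma integral_even_period:
  fixes f :: "real \<Rightarrow> real"
  assumes c: "continuous_on UNIV f" and T: "0 \<le> T" "\<And>x. f (x + 2 * T) = f x" and even: "\<And>x. f (- x) = f x"
  shows "integral {0..2 * T} f = 2 * integral {0..T} f"
proof -
  have "integral {0..2 * T} f = integral {- T..- T + 2 * T} f"
    using integral_periodic[OF c _ T(2), of "- T"] T(1) by simp
  also have "\<dots> = integral {- T..T} f" by simp
  also have "\<dots> = integral {- T..0} f + integral {0..T} f"
    using T(1) by (intro Henstock_Kurzweil_Integration.integral_combine[symmetric] integrable_continuous_real continuous_on_subset[OF c]) auto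
  also have "integral {- T..0} f = integral {0..T} f"
    using Henstock_Kurzweil_Integration.integral_reflect_real[of T 0 f] by (simp add: even)
  finally show ?thesis by simp
qed

lemma integral_sin_power_cos: "integral {0..pi} (\<lambda>\<theta>. sin \<theta> ^ k * cos \<theta>) = 0"
proof -
  have "((\<lambda>\<theta>. sin \<theta> ^ Suc k / real (Suc k)) has_real_derivative sin \<theta> ^ k * cos \<theta>) (at \<theta>)" for \<theta>
    by (auto intro!: derivative_eq_intros simp del: power_Suc of_nat_Suc)
  from integral_FTC_real[OF _ this, of 0 pi] show ?thesis by simp
qed

definition autocorrelation :: "(real \<Rightarrow> real) \<Rightarrow> real \<Rightarrow> real" where
  "autocorrelation h \<theta> = integral {0..2 * pi} (\<lambda>\<phi>. h \<phi> * h (\<phi> + \<theta>))"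

lemma autocorrelation_even:
  assumes "continuous_on UNIV h" "\<And>x. h (x + 2 * pi) = h x"
  shows "autocorrelation h (- \<theta>) = autocorrelation h \<theta>"
proof -
  have "integral {0..2 * pi} (\<lambda>\<phi>. h (\<phi> + \<theta>) * h (\<phi> + \<theta> + - \<theta>)) = autocorrelation h (- \<theta>)"
    unfolding autocorrelation_def
  proof (rule integral_shift_period[of "\<lambda>\<phi>. h \<phi> * h (\<phi> + - \<theta>)"])
    show "continuous_on UNIV (\<lambda>\<phi>. h \<phi> * h (\<phi> + - \<theta>))"
      by (intro continuous_intros assms(1) continuous_on_compose2[OF assms(1)]) auto
    show "h (x + 2 * pi) * h (x + 2 * pi + - \<theta>) = h x * h (x + - \<theta>)" for x
      using assms(2)[of "x + - \<theta>"] by (simp only: assms(2) add.assoc add.commute[of "2 * pi"])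
  qed simp
  then show ?thesis by (simp add: autocorrelation_def mult.commute)
qed

lemma autocorrelation_periodic:
  assumes "\<And>x. h (x + 2 * pi) = h x" shows "autocorrelation h (\<theta> + 2 * pi) = autocorrelation h \<theta>"
  unfolding autocorrelation_def add.assoc[symmetric] assms ..

lemma continuous_on_autocorrelation:
  assumes h: "continuous_on UNIV h" shows "continuous_on S (autocorrelation h)"
proof -
  have "continuous_on UNIV (\<lambda>\<theta>. integral (cbox 0 (2 * pi)) (\<lambda>\<phi>. h \<phi> * h (\<phi> + \<theta>)))"
    by (intro integral_continuous_on_param)
      (auto simp: split_beta intro!: continuous_intros continuous_on_compose2[OF h])
  then show ?thesis unfolding autocorrelation_def[abs_def] by (auto intro: continuous_on_subset)
qed

context convex_oval
begin

abbreviation "h \<equiv> support_fun K"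

lemma h_cont: "continuous_on S h" by (rule continuous_on_support_fun[OF K(1) K_nonempty])

lemma h_comp_cont: "continuous_on S f \<Longrightarrow> continuous_on S (\<lambda>x. h (f x))"
  by (rule continuous_on_compose2[OF h_cont[of UNIV]]) auto

lemma \<nu>_comp_cont: "continuous_on S f \<Longrightarrow> continuous_on S (\<lambda>x. \<nu> (f x))"
  by (rule continuous_on_compose2[OF continuous_on_\<nu>[of UNIV]]) auto

text \<open>The tangential coordinate of the contact point. It plays the role of the derivative of the support
  function with respect to the normal angle (see \<open>h_deriv\<close>).\<close>

definition tangential :: "real \<Rightarrow> real" where "tangential t = \<gamma> t \<bullet> tang_at (\<nu> t)"

lemma continuous_on_tangential: "continuous_on S tangential"
  unfolding tangential_def[abs_def]
  by (intro continuous_intros continuous_on_\<gamma> continuous_on_compose2[OF continuous_on_tang_at[of UNIV] continuous_on_\<nu>]) auto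

lemma tangential_comp_cont: "continuous_on S f \<Longrightarrow> continuous_on S (\<lambda>x. tangential (f x))"
  by (rule continuous_on_compose2[OF continuous_on_tangential[of UNIV]]) auto

lemma \<nu>'_comp_cont: "continuous_on S f \<Longrightarrow> continuous_on S (\<lambda>x. \<nu>' (f x))"
  by (rule continuous_on_compose2[OF \<nu>'_cont]) auto

lemmas cont_rules = continuous_intros h_comp_cont \<nu>_comp_cont tangential_comp_cont \<nu>'_comp_cont

lemma h_deriv: "((\<lambda>t. h (\<nu> t)) has_real_derivative \<nu>' t * tangential t) (at t)"
proof -
  have "((\<lambda>t. \<gamma> t \<bullet> unit_at (\<nu> t)) has_real_derivative
      ((\<sigma> t *\<^sub>R tang_at (\<nu> t)) \<bullet> unit_at (\<nu> t) + \<gamma> t \<bullet> (\<nu>' t *\<^sub>R tang_at (\<nu> t)))) (at t)"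
    by (intro inner_DERIV \<gamma>_deriv unit_at_comp_derivative \<nu>_deriv)
  then show ?thesis by (simp add: support_fun_on_curve tangential_def)
qed

lemma h_closes: "h (\<nu> 1) = h (\<nu> 0)" unfolding turning_number_one by (rule support_fun_periodic)

lemma integral_over_normal:
  assumes "continuous_on UNIV F" "\<And>x. F (x + 2 * pi) = F x"
  shows "integral {0..1} (\<lambda>t. \<nu>' t * F (\<nu> t)) = integral {0..2 * pi} F"
proof -
  have "((\<lambda>t. \<nu>' t *\<^sub>R F (\<nu> t)) has_integral (integral {\<nu> 0..\<nu> 1} F)) {0..1}"
    by (rule has_integral_substitution[where c = "\<nu> 0" and d = "\<nu> 1"])
      (auto intro: angle_mono continuous_on_subset[OF assms(1)] has_field_derivative_at_within \<nu>_deriv)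
  then have "integral {0..1} (\<lambda>t. \<nu>' t * F (\<nu> t)) = integral {\<nu> 0..\<nu> 0 + 2 * pi} F"
    by (simp add: integral_unique turning_number_one)
  also have "\<dots> = integral {0..2 * pi} F" using integral_periodic[OF assms(1) _ assms(2)] by simp
  finally show ?thesis .
qed

lemma h_shift_periodic: "h (x + 2 * pi + \<theta>) = h (x + \<theta>)"
proof -
  have "x + 2 * pi + \<theta> = (x + \<theta>) + 2 * pi" by simp
  then show ?thesis by (simp only: support_fun_periodic)
qed

text \<open>Formally the integral of \<open>h'(\<phi>) h(\<phi> + \<theta>)\<close> over a period.\<close>

definition tangential_correlation :: "real \<Rightarrow> real" where
  "tangential_correlation \<theta> = integral {0..1} (\<lambda>t. \<nu>' t * tangential t * h (\<nu> t + \<theta>))"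

lemma autocorrelation_on_curve:
  "autocorrelation h \<theta> = integral {0..1} (\<lambda>t. \<nu>' t * (h (\<nu> t) * h (\<nu> t + \<theta>)))"
proof -
  have "h (x + 2 * pi + \<theta>) = h (x + \<theta>)" for x
    by (rule h_shift_periodic)
  then show ?thesis
    unfolding autocorrelation_def
    by (intro integral_over_normal[symmetric] cont_rules) (simp add: support_fun_periodic)
qed

text \<open>With an antiderivative \<open>G\<close> of \<open>h\<close>, integration by parts along the curve writes the
  autocorrelation as a constant minus the integral \<open>D\<close> of \<open>h' G(\<nu> + \<theta>)\<close>. In \<open>D\<close> the
  dependence on \<open>\<theta>\<close> is through a differentiable function, so that one can differentiate under the
  integral sign.\<close>

lemma autocorrelation_deriv: "(autocorrelation h has_real_derivative - tangential_correlation \<theta>) (at \<theta>)"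
proof -
  obtain G where G: "\<And>x. (G has_real_derivative h x) (at x)" using antiderivative_exists[OF h_cont] by blast
  have "continuous_on UNIV G" by (rule DERIV_continuous_on[OF has_field_derivative_at_within[OF G]])
  then have cG: "continuous_on S (\<lambda>x. G (f x))" if "continuous_on S f" for S :: "'b::topological_space set" and f
    using that by (rule continuous_on_compose2) simp
  define D where "D \<theta> = integral {0..1} (\<lambda>t. \<nu>' t * tangential t * G (\<nu> t + \<theta>))" for \<theta>
  have "((\<lambda>\<theta>. integral (cbox 0 1) (\<lambda>t. \<nu>' t * tangential t * G (\<nu> t + \<theta>))) has_field_derivative
      integral (cbox 0 1) (\<lambda>t. \<nu>' t * tangential t * h (\<nu> t + \<theta>))) (at \<theta> within UNIV)"
  proof (rule leibniz_rule_field_derivative)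
    show "((\<lambda>\<theta>. \<nu>' t * tangential t * G (\<nu> t + \<theta>)) has_real_derivative \<nu>' t * tangential t * h (\<nu> t + \<theta>)) (at \<theta> within UNIV)" for \<theta> t
    proof -
      have "((\<lambda>\<theta>. G (\<theta> + \<nu> t)) has_real_derivative h (\<theta> + \<nu> t)) (at \<theta>)"
        using G[of "\<theta> + \<nu> t"] unfolding DERIV_shift .
      then show ?thesis by (intro DERIV_cmult) (simp add: add.commute)
    qed
    show "(\<lambda>t. \<nu>' t * tangential t * G (\<nu> t + \<theta>)) integrable_on cbox 0 1" for \<theta>
      by (intro integrable_continuous cont_rules cG)
    show "continuous_on (UNIV \<times> cbox 0 1) (\<lambda>(\<theta>, t). \<nu>' t * tangential t * h (\<nu> t + \<theta>))"
      unfolding split_beta by (intro cont_rules)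
  qed auto
  then have dD: "(D has_real_derivative tangential_correlation \<theta>) (at \<theta>)" by (simp add: D_def[abs_def] tangential_correlation_def)
  let ?c = "h (\<nu> 0) * integral {0..2 * pi} h"
  have "autocorrelation h \<theta> = ?c - D \<theta>" for \<theta>
  proof -
    let ?f = "\<lambda>t. \<nu>' t * tangential t * G (\<nu> t + \<theta>)" and ?g = "\<lambda>t. \<nu>' t * (h (\<nu> t) * h (\<nu> t + \<theta>))"
    have d: "((\<lambda>t. h (\<nu> t) * G (\<nu> t + \<theta>)) has_real_derivative ?f t + ?g t) (at t)" for t
    proof -
      have "((\<lambda>t. G (\<nu> t + \<theta>)) has_real_derivative h (\<nu> t + \<theta>) * (\<nu>' t + 0)) (at t)"
        by (rule DERIV_chain2[OF G]) (intro DERIV_add \<nu>_deriv DERIV_const)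
      from DERIV_mult[OF h_deriv this] show ?thesis by (simp add: algebra_simps)
    qed
    have "integral {0..1} (\<lambda>t. ?f t + ?g t) = h (\<nu> 1) * G (\<nu> 1 + \<theta>) - h (\<nu> 0) * G (\<nu> 0 + \<theta>)"
      by (rule integral_FTC_real[OF _ d]) simp
    also have "\<dots> = h (\<nu> 0) * (G ((\<nu> 0 + \<theta>) + 2 * pi) - G (\<nu> 0 + \<theta>))"
      unfolding h_closes unfolding turning_number_one by (simp add: algebra_simps)
    also have "G ((\<nu> 0 + \<theta>) + 2 * pi) - G (\<nu> 0 + \<theta>) = integral {\<nu> 0 + \<theta>..(\<nu> 0 + \<theta>) + 2 * pi} h"
      by (rule integral_FTC_real[OF _ G, symmetric]) simp
    also have "\<dots> = integral {0..2 * pi} h"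
      by (rule integral_periodic[OF h_cont _ support_fun_periodic]) simp
    finally have "integral {0..1} (\<lambda>t. ?f t + ?g t) = ?c" .
    moreover have "integral {0..1} (\<lambda>t. ?f t + ?g t) = D \<theta> + autocorrelation h \<theta>"
      unfolding D_def autocorrelation_on_curve
      by (intro Henstock_Kurzweil_Integration.integral_add integrable_continuous_real cont_rules cG)
    ultimately show ?thesis by simp
  qed
  then have "autocorrelation h = (\<lambda>\<theta>. ?c - D \<theta>)" by (rule ext)
  then show ?thesis using DERIV_diff[OF DERIV_const[of ?c] dD] by simp
qed

lemma continuous_on_tangential_correlation: "continuous_on S tangential_correlation"
proof -
  have "continuous_on UNIV (\<lambda>\<theta>. integral (cbox 0 1) (\<lambda>t. \<nu>' t * tangential t * h (\<nu> t + \<theta>)))"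
    by (intro integral_continuous_on_param) (unfold split_beta, intro cont_rules)
  then show ?thesis unfolding tangential_correlation_def[abs_def] by (auto intro: continuous_on_subset)
qed

text \<open>The gap is \<open>h(\<nu> + \<theta>) - h(\<nu>) cos \<theta> - h'(\<nu>) sin \<theta>\<close>. Of the six terms of its square, the
  integrals of \<open>h(\<nu> + \<theta>)\<^sup>2\<close> and \<open>h(\<nu>)\<^sup>2\<close> agree by periodicity, and the one of \<open>h h'\<close>
  vanishes.\<close>

lemma mean_square_gap_expand:
  "\<exists>a b. \<forall>\<theta>. mean_square_gap \<theta> = a + b * (sin \<theta>)\<^sup>2 - 2 * cos \<theta> * autocorrelation h \<theta> - 2 * sin \<theta> * tangential_correlation \<theta>"
proof -
  define C where "C = integral {0..2 * pi} (\<lambda>\<phi>. (h \<phi>)\<^sup>2)"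
  define E where "E = integral {0..1} (\<lambda>t. \<nu>' t * (tangential t)\<^sup>2)"
  have C1: "integral {0..1} (\<lambda>t. \<nu>' t * (h (\<nu> t + \<theta>))\<^sup>2) = C" for \<theta>
  proof -
    have "h (x + 2 * pi + \<theta>) = h (x + \<theta>)" for x
      by (rule h_shift_periodic)
    then have "integral {0..1} (\<lambda>t. \<nu>' t * (h (\<nu> t + \<theta>))\<^sup>2) = integral {0..2 * pi} (\<lambda>\<phi>. (h (\<phi> + \<theta>))\<^sup>2)"
      by (intro integral_over_normal cont_rules) simp
    also have "\<dots> = C" unfolding C_def
      by (intro integral_shift_period[of "\<lambda>\<phi>. (h \<phi>)\<^sup>2"] cont_rules) (simp_all add: support_fun_periodic)
    finally show ?thesis .
  qed
  have C0: "integral {0..1} (\<lambda>t. \<nu>' t * (h (\<nu> t))\<^sup>2) = C" using C1[of 0] by simp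
  have Z: "integral {0..1} (\<lambda>t. \<nu>' t * tangential t * h (\<nu> t)) = 0"
  proof -
    have "((\<lambda>t. (h (\<nu> t))\<^sup>2 / 2) has_real_derivative \<nu>' t * tangential t * h (\<nu> t)) (at t)" for t
      by (auto intro!: derivative_eq_intros h_deriv)
    from integral_FTC_real[OF _ this, of 0 1] show ?thesis by (simp add: h_closes)
  qed
  have "mean_square_gap \<theta> = 2 * C + (E - C) * (sin \<theta>)\<^sup>2 - 2 * cos \<theta> * autocorrelation h \<theta> - 2 * sin \<theta> * tangential_correlation \<theta>" for \<theta>
  proof -
    let ?F = "\<lambda>t. \<nu>' t * (h (\<nu> t + \<theta>))\<^sup>2 + (cos \<theta>)\<^sup>2 * (\<nu>' t * (h (\<nu> t))\<^sup>2) + (sin \<theta>)\<^sup>2 * (\<nu>' t * (tangential t)\<^sup>2)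
      - 2 * cos \<theta> * (\<nu>' t * (h (\<nu> t) * h (\<nu> t + \<theta>))) - 2 * sin \<theta> * (\<nu>' t * tangential t * h (\<nu> t + \<theta>))
      + 2 * sin \<theta> * cos \<theta> * (\<nu>' t * tangential t * h (\<nu> t))"
    have F: "\<nu>' t * (gap t \<theta>)\<^sup>2 = ?F t" for t
    proof -
      have g: "gap t \<theta> = h (\<nu> t + \<theta>) - (cos \<theta> * h (\<nu> t) + sin \<theta> * tangential t)"
      proof -
        have "\<gamma> t \<bullet> unit_at (\<nu> t + \<theta>) = cos \<theta> * (\<gamma> t \<bullet> unit_at (\<nu> t)) + sin \<theta> * (\<gamma> t \<bullet> tang_at (\<nu> t))"
          unfolding inner_real2 tang_at_nth unit_at_nth cos_add sin_add by algebra
        then show ?thesis by (simp add: gap_def support_fun_on_curve tangential_def)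
      qed
      show ?thesis unfolding g by algebra
    qed
    have int: "f integrable_on {0..1}" if "continuous_on {0..1} f" for f :: "real \<Rightarrow> real"
      using that by (rule integrable_continuous_real)
    have "mean_square_gap \<theta> = integral {0..1} ?F" unfolding mean_square_gap_def F ..
    also have "\<dots> = integral {0..1} (\<lambda>t. \<nu>' t * (h (\<nu> t + \<theta>))\<^sup>2) + (cos \<theta>)\<^sup>2 * integral {0..1} (\<lambda>t. \<nu>' t * (h (\<nu> t))\<^sup>2)
      + (sin \<theta>)\<^sup>2 * integral {0..1} (\<lambda>t. \<nu>' t * (tangential t)\<^sup>2)
      - 2 * cos \<theta> * integral {0..1} (\<lambda>t. \<nu>' t * (h (\<nu> t) * h (\<nu> t + \<theta>)))
      - 2 * sin \<theta> * integral {0..1} (\<lambda>t. \<nu>' t * tangential t * h (\<nu> t + \<theta>))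
      + 2 * sin \<theta> * cos \<theta> * integral {0..1} (\<lambda>t. \<nu>' t * tangential t * h (\<nu> t))"
      by (intro integral_unique has_integral_add has_integral_diff has_integral_mult_right integrable_integral int cont_rules)
    also have "\<dots> = C + (cos \<theta>)\<^sup>2 * C + (sin \<theta>)\<^sup>2 * E - 2 * cos \<theta> * autocorrelation h \<theta> - 2 * sin \<theta> * tangential_correlation \<theta>"
      unfolding C1 C0 Z E_def[symmetric] tangential_correlation_def[symmetric] autocorrelation_on_curve[symmetric] by simp
    also have "\<dots> = 2 * C + (E - C) * (sin \<theta>)\<^sup>2 - 2 * cos \<theta> * autocorrelation h \<theta> - 2 * sin \<theta> * tangential_correlation \<theta>"
      unfolding cos_squared_eq by (simp add: algebra_simps)
    finally show ?thesis .
  qed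
  then show ?thesis by blast
qed

text \<open>The terms with \<open>a\<close> and \<open>b\<close> vanish because \<open>sin\<^sup>k cos\<close> has integral 0 over \<open>[0, \<pi>]\<close>. The
  term with the derivative of the autocorrelation is integrated by parts; its boundary values vanish
  with \<open>sin\<close>.\<close>

lemma mean_square_gap_integral:
  "integral {0..pi} (\<lambda>\<theta>. sin \<theta> ^ n * cos \<theta> * mean_square_gap \<theta>) =
   - 2 * integral {0..pi} (\<lambda>\<theta>. autocorrelation h \<theta> * (real (n + 2) * sin \<theta> ^ n - real (n + 3) * sin \<theta> ^ (n + 2)))"
proof -
  let ?A = "autocorrelation h"
  note cA = continuous_on_autocorrelation[OF h_cont]
  have int: "f integrable_on {0..pi}" if "continuous_on {0..pi} f" for f :: "real \<Rightarrow> real"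
    using that by (rule integrable_continuous_real)
  obtain a b where Q: "\<And>\<theta>. mean_square_gap \<theta> = a + b * (sin \<theta>)\<^sup>2 - 2 * cos \<theta> * ?A \<theta> - 2 * sin \<theta> * tangential_correlation \<theta>"
    using mean_square_gap_expand by blast
  \<comment> \<open>the derivative of \<open>sin\<^sup>n\<^sup>+\<^sup>1 cos\<close>\<close>
  let ?w = "\<lambda>\<theta>. (real n + 1) * sin \<theta> ^ n * (cos \<theta>)\<^sup>2 - sin \<theta> ^ (n + 2)"
  have parts: "((\<lambda>\<theta>. sin \<theta> ^ (n + 1) * cos \<theta> * ?A \<theta>) has_real_derivative
      ?A \<theta> * ?w \<theta> - sin \<theta> ^ (n + 1) * cos \<theta> * tangential_correlation \<theta>) (at \<theta>)" for \<theta>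
    by (rule derivative_eq_intros autocorrelation_deriv refl)+ (simp add: power2_eq_square algebra_simps)
  have 0: "integral {0..pi} (\<lambda>\<theta>. ?A \<theta> * ?w \<theta> - sin \<theta> ^ (n + 1) * cos \<theta> * tangential_correlation \<theta>) = 0"
    using integral_FTC_real[OF _ parts, of 0 pi] by simp
  let ?F = "\<lambda>\<theta>. a * (sin \<theta> ^ n * cos \<theta>) + b * (sin \<theta> ^ (n + 2) * cos \<theta>)
      - 2 * (?A \<theta> * (real (n + 2) * sin \<theta> ^ n - real (n + 3) * sin \<theta> ^ (n + 2)))
      + 2 * (?A \<theta> * ?w \<theta> - sin \<theta> ^ (n + 1) * cos \<theta> * tangential_correlation \<theta>)"
  have F: "sin \<theta> ^ n * cos \<theta> * mean_square_gap \<theta> = ?F \<theta>" for \<theta>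
  proof -
    have "p * c * (a + b * s\<^sup>2 - 2 * c * A - 2 * s * M) = a * (p * c) + b * (p * s\<^sup>2 * c)
        - 2 * (A * ((N + 2) * p - (N + 3) * (p * s\<^sup>2)))
        + 2 * (A * ((N + 1) * p * c\<^sup>2 - p * s\<^sup>2) - p * s * c * M)"
      if "c\<^sup>2 = 1 - s\<^sup>2" for p s c A M N :: real
      using that by algebra
    from this[OF cos_squared_eq, of "sin \<theta> ^ n" \<theta> "?A \<theta>" "tangential_correlation \<theta>" "real n"]
    show ?thesis by (simp only: Q power_add power_one_right of_nat_add of_nat_numeral)
  qed
  have "integral {0..pi} (\<lambda>\<theta>. sin \<theta> ^ n * cos \<theta> * mean_square_gap \<theta>) = integral {0..pi} ?F" unfolding F ..
  also have "\<dots> = a * integral {0..pi} (\<lambda>\<theta>. sin \<theta> ^ n * cos \<theta>) + b * integral {0..pi} (\<lambda>\<theta>. sin \<theta> ^ (n + 2) * cos \<theta>)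
      - 2 * integral {0..pi} (\<lambda>\<theta>. ?A \<theta> * (real (n + 2) * sin \<theta> ^ n - real (n + 3) * sin \<theta> ^ (n + 2)))
      + 2 * integral {0..pi} (\<lambda>\<theta>. ?A \<theta> * ?w \<theta> - sin \<theta> ^ (n + 1) * cos \<theta> * tangential_correlation \<theta>)"
    by (intro integral_unique has_integral_add has_integral_diff has_integral_mult_right integrable_integral int
        continuous_intros cA continuous_on_tangential_correlation)
  finally show ?thesis unfolding 0 integral_sin_power_cos by simp
qed

end

section \<open>Integrals over pairs of lines\<close>

lemma set_integrable_bounded:
  fixes f :: "'a::euclidean_space \<Rightarrow> real"
  assumes S: "S \<in> sets borel" "bounded S" and f: "f \<in> borel_measurable borel" "\<And>x. \<bar>f x\<bar> \<le> B"
  shows "set_integrable lborel S f"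
  unfolding set_integrable_def
proof (rule integrableI_bounded_set[where A = S and B = B])
  show "(\<lambda>x. indicator S x *\<^sub>R f x) \<in> borel_measurable lborel" using S f by simp
  show "AE x in lborel. x \<in> S \<longrightarrow> norm (indicator S x *\<^sub>R f x) \<le> B" using f(2) by (intro AE_I2) auto
qed (use S emeasure_bounded_finite in auto)

lemma lines_meeting_bounded_borel:
  assumes K: "compact K" "convex K" "0 \<in> interior K"
  shows "lines_meeting K \<in> sets borel" "bounded (lines_meeting K)"
proof -
  have ne: "K \<noteq> {}" using K(3) interior_subset by auto
  have hm: "(\<lambda>z::real \<times> real. support_fun K (snd z)) \<in> borel_measurable borel"
    by (intro borel_measurable_continuous_onI continuous_on_compose2[OF continuous_on_support_fun[OF K(1) ne, of UNIV]] continuous_intros) auto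
  have f: "(\<lambda>z::real \<times> real. fst z) \<in> borel_measurable borel" and s: "(\<lambda>z::real \<times> real. snd z) \<in> borel_measurable borel"
    by (intro borel_measurable_continuous_onI continuous_intros)+
  note [measurable] = hm f s
  have eq: "lines_meeting K = {z. 0 < fst z \<and> fst z \<le> support_fun K (snd z) \<and> 0 \<le> snd z \<and> snd z < 2 * pi}"
    unfolding lines_meeting_eq[OF K] by auto
  show "lines_meeting K \<in> sets borel" unfolding eq by measurable
  have "compact (support_fun K ` {0..2 * pi})"
    by (intro compact_continuous_image continuous_on_support_fun K(1) ne) simp
  then obtain H where "\<forall>y\<in>support_fun K ` {0..2 * pi}. norm y \<le> H"
    using compact_imp_bounded bounded_iff by metis
  then have H: "\<And>a. a \<in> {0..2 * pi} \<Longrightarrow> \<bar>support_fun K a\<bar> \<le> H" by auto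
  have "lines_meeting K \<subseteq> cbox (0, 0) (H, 2 * pi)"
  proof
    fix z assume "z \<in> lines_meeting K"
    then have "0 < fst z" "fst z \<le> support_fun K (snd z)" "0 \<le> snd z" "snd z < 2 * pi" by (auto simp: eq)
    moreover from this have "\<bar>support_fun K (snd z)\<bar> \<le> H" by (intro H) auto
    ultimately show "z \<in> cbox (0, 0) (H, 2 * pi)"
      unfolding cbox_Pair_eq by (simp add: mem_Times_iff)
  qed
  then show "bounded (lines_meeting K)" using bounded_cbox bounded_subset by blast
qed

lemma lines_meeting_integral:
  assumes K: "compact K" "convex K" "0 \<in> interior K"
    and c: "continuous_on UNIV c" "\<And>a. \<bar>c a\<bar> \<le> B"
  shows "(LINT z : lines_meeting K | lborel. c (snd z)) = integral {0..2 * pi} (\<lambda>a. support_fun K a * c a)"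
proof -
  have ne: "K \<noteq> {}" using K(3) interior_subset by auto
  have cm: "(\<lambda>z::real \<times> real. c (snd z)) \<in> borel_measurable borel"
    by (intro borel_measurable_continuous_onI continuous_on_compose2[OF c(1)] continuous_intros) auto
  have "set_integrable lborel (lines_meeting K) (\<lambda>z. c (snd z))"
    using lines_meeting_bounded_borel[OF K] cm c(2) by (rule set_integrable_bounded)
  then have int: "integrable (lborel \<Otimes>\<^sub>M lborel) (\<lambda>(p, a). indicator (lines_meeting K) (p, a) * c a)"
    by (simp add: set_integrable_def lborel_prod case_prod_beta')
  have "(LINT z : lines_meeting K | lborel. c (snd z)) = (LINT z | (lborel \<Otimes>\<^sub>M lborel). (case z of (p, a) \<Rightarrow> indicator (lines_meeting K) (p, a) * c a))"
    by (simp add: set_lebesgue_integral_def lborel_prod case_prod_beta')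
  also have "\<dots> = (LINT a | lborel. LINT p | lborel. indicator (lines_meeting K) (p, a) * c a)"
    by (rule lborel_pair.integral_snd[OF int, symmetric])
  also have "\<dots> = (LINT a | lborel. indicator {0..<2 * pi} a *\<^sub>R (support_fun K a * c a))"
  proof (intro Bochner_Integration.integral_cong refl)
    fix a
    have sec: "indicator (lines_meeting K) (p, a) * c a = indicator {0<..support_fun K a} p * (indicator {0..<2 * pi} a * c a)" for p
      unfolding lines_meeting_eq[OF K] by (simp add: indicator_def)
    show "(LINT p | lborel. indicator (lines_meeting K) (p, a) * c a) = indicator {0..<2 * pi} a *\<^sub>R (support_fun K a * c a)"
      unfolding sec using support_fun_pos[OF K(1,3), of a] by simp
  qed
  also have "\<dots> = (LINT a : {0..2 * pi} | lborel. support_fun K a * c a)"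
    unfolding set_lebesgue_integral_def
  proof (rule integral_cong_AE)
    have [measurable]: "(\<lambda>a. support_fun K a * c a) \<in> borel_measurable borel"
      by (intro borel_measurable_continuous_onI continuous_intros continuous_on_support_fun K(1) ne c)
    show "(\<lambda>a. indicator {0..<2 * pi} a *\<^sub>R (support_fun K a * c a)) \<in> borel_measurable lborel"
      "(\<lambda>a. indicator {0..2 * pi} a *\<^sub>R (support_fun K a * c a)) \<in> borel_measurable lborel" by measurable
    show "AE a in lborel. indicator {0..<2 * pi} a *\<^sub>R (support_fun K a * c a) = indicator {0..2 * pi} a *\<^sub>R (support_fun K a * c a)"
      by (rule eventually_mono[OF AE_lborel_singleton[of "2 * pi"]]) (auto simp: indicator_def)
  qed
  also have "\<dots> = integral {0..2 * pi} (\<lambda>a. support_fun K a * c a)"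
    by (intro set_borel_integral_eq_integral borel_integrable_atLeastAtMost' continuous_intros continuous_on_support_fun K(1) ne
        continuous_on_subset[OF c(1)]) auto
  finally show ?thesis .
qed

text \<open>Integrating out the distances gives \<open>h(\<phi>\<^sub>1) h(\<phi>\<^sub>2) g(\<phi>\<^sub>2 - \<phi>\<^sub>1)\<close>; substituting
  \<open>\<phi>\<^sub>2 = \<phi>\<^sub>1 + \<theta>\<close> and exchanging the integrals produces the autocorrelation.\<close>

lemma line_pairs_integral:
  assumes K: "compact K" "convex K" "0 \<in> interior K"
    and g: "continuous_on UNIV g" "\<And>x. g (x + 2 * pi) = g x" "\<And>x. g (- x) = g x" "\<And>x. \<bar>g x\<bar> \<le> B"
  shows "set_integrable lborel (lines_meeting K \<times> lines_meeting K) (\<lambda>z. g (snd (snd z) - snd (fst z)))"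
    and "(LINT z : lines_meeting K \<times> lines_meeting K | lborel. g (snd (snd z) - snd (fst z)))
      = 2 * integral {0..pi} (\<lambda>\<theta>. autocorrelation (support_fun K) \<theta> * g \<theta>)"
proof -
  let ?L = "lines_meeting K"
  let ?h = "support_fun K"
  have ne: "K \<noteq> {}" using K(3) interior_subset by auto
  have hc: "continuous_on S ?h" for S by (rule continuous_on_support_fun[OF K(1) ne])
  have hcc: "continuous_on S (\<lambda>x. ?h (f x))" if "continuous_on S f" for S :: "'b::topological_space set" and f
    by (rule continuous_on_compose2[OF hc[of UNIV] that]) simp
  have gcc: "continuous_on S (\<lambda>x. g (f x))" if "continuous_on S f" for S :: "'b::topological_space set" and f
    by (rule continuous_on_compose2[OF g(1) that]) simp
  have Lm: "?L \<in> sets borel" and Lb: "bounded ?L" using lines_meeting_bounded_borel[OF K] by auto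
  have LLm: "?L \<times> ?L \<in> sets borel" using Lm by (simp add: borel_prod[symmetric])
  have gm: "(\<lambda>z::(real \<times> real) \<times> (real \<times> real). g (snd (snd z) - snd (fst z))) \<in> borel_measurable borel"
    by (intro borel_measurable_continuous_onI gcc continuous_intros)
  show si: "set_integrable lborel (?L \<times> ?L) (\<lambda>z. g (snd (snd z) - snd (fst z)))"
    using LLm bounded_Times[OF Lb Lb] gm g(4) by (rule set_integrable_bounded)
  \<comment> \<open>the inner integral, as a function of the direction \<open>a\<close> of the first line\<close>
  define C where "C a = integral {0..2 * pi} (\<lambda>b. ?h b * g (b - a))" for a
  have C: "continuous_on UNIV C"
  proof -
    have "continuous_on UNIV (\<lambda>a. integral (cbox 0 (2 * pi)) (\<lambda>b. ?h b * g (b - a)))"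
      by (intro integral_continuous_on_param) (unfold split_beta, intro continuous_intros hcc gcc)
    then show ?thesis by (simp add: C_def[abs_def])
  qed
  have C_shift: "C a = integral {0..2 * pi} (\<lambda>\<theta>. ?h (a + \<theta>) * g \<theta>)" for a
  proof -
    have "integral {0..2 * pi} (\<lambda>\<theta>. ?h (\<theta> + a) * g (\<theta> + a - a)) = C a"
      unfolding C_def
    proof (rule integral_shift_period[of "\<lambda>b. ?h b * g (b - a)"])
      show "continuous_on UNIV (\<lambda>b. ?h b * g (b - a))" by (intro continuous_intros hcc gcc)
      show "?h (x + 2 * pi) * g (x + 2 * pi - a) = ?h x * g (x - a)" for x
        using g(2)[of "x - a"] support_fun_periodic[of K x] by (simp add: algebra_simps)
    qed simp
    then show ?thesis by (simp add: add.commute)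
  qed
  have C_per: "C (a + 2 * pi) = C a" for a
  proof -
    have "a + 2 * pi + \<theta> = (a + \<theta>) + 2 * pi" for \<theta> by simp
    then show ?thesis unfolding C_shift by (simp only: support_fun_periodic)
  qed
  have "\<exists>B. \<forall>a. \<bar>C a\<bar> \<le> B"
  proof -
    have "continuous_on {0..2 * pi} ?h" by (rule hc)
    have *: "\<bar>C a\<bar> \<le> integral {0..2 * pi} (\<lambda>b. ?h b * B)" for a
      unfolding C_def real_norm_def[symmetric]
    proof (rule integral_norm_bound_integral)
      show "(\<lambda>b. ?h b * g (b - a)) integrable_on {0..2 * pi}" "(\<lambda>b. ?h b * B) integrable_on {0..2 * pi}"
        by (intro integrable_continuous_real continuous_intros hcc gcc)+
      show "norm (?h b * g (b - a)) \<le> ?h b * B" for b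
        using support_fun_pos[OF K(1,3), of b] g(4)[of "b - a"] by (simp add: abs_mult)
    qed
    then show ?thesis by blast
  qed
  then obtain B' where B': "\<And>a. \<bar>C a\<bar> \<le> B'" by blast
  have "(LINT z : ?L \<times> ?L | lborel. g (snd (snd z) - snd (fst z)))
      = (LINT z | (lborel \<Otimes>\<^sub>M lborel). indicator (?L \<times> ?L) z *\<^sub>R g (snd (snd z) - snd (fst z)))"
    by (simp add: set_lebesgue_integral_def lborel_prod)
  also have "\<dots> = (LINT u | lborel. LINT v | lborel. indicator (?L \<times> ?L) (u, v) *\<^sub>R g (snd (snd (u, v)) - snd (fst (u, v))))"
    using si unfolding set_integrable_def by (intro lborel_pair.integral_fst'[symmetric]) (simp add: lborel_prod)
  also have "\<dots> = (LINT u : ?L | lborel. C (snd u))"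
    unfolding set_lebesgue_integral_def
  proof (intro Bochner_Integration.integral_cong refl)
    fix u :: "real \<times> real"
    have "(LINT v | lborel. indicator (?L \<times> ?L) (u, v) *\<^sub>R g (snd (snd (u, v)) - snd (fst (u, v))))
      = (LINT v | lborel. indicator ?L u * (indicator ?L v *\<^sub>R g (snd v - snd u)))"
      by (intro Bochner_Integration.integral_cong refl) (simp add: indicator_times)
    also have "\<dots> = indicator ?L u * (LINT v : ?L | lborel. g (snd v - snd u))"
      by (simp add: set_lebesgue_integral_def)
    also have "(LINT v : ?L | lborel. g (snd v - snd u)) = C (snd u)"
      unfolding C_def by (rule lines_meeting_integral[OF K, of "\<lambda>b. g (b - snd u)" B]) (use g(4) in \<open>auto intro!: gcc continuous_intros\<close>)
    finally show "(LINT v | lborel. indicator (?L \<times> ?L) (u, v) *\<^sub>R g (snd (snd (u, v)) - snd (fst (u, v)))) = indicator ?L u *\<^sub>R C (snd u)"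
      by simp
  qed
  also have "\<dots> = integral {0..2 * pi} (\<lambda>a. ?h a * C a)"
    by (rule lines_meeting_integral[OF K C B'])
  also have "\<dots> = integral {0..2 * pi} (\<lambda>a. integral {0..2 * pi} (\<lambda>\<theta>. ?h a * (?h (a + \<theta>) * g \<theta>)))"
    unfolding C_shift by simp
  also have "\<dots> = integral {0..2 * pi} (\<lambda>\<theta>. integral {0..2 * pi} (\<lambda>a. ?h a * (?h (a + \<theta>) * g \<theta>)))"
    using integral_swap_continuous[of 0 0 "2 * pi" "2 * pi" "\<lambda>a \<theta>. ?h a * (?h (a + \<theta>) * g \<theta>)"]
    by (simp add: split_beta continuous_on_mult hcc gcc continuous_on_add continuous_on_fst continuous_on_snd continuous_on_id)
  also have "\<dots> = integral {0..2 * pi} (\<lambda>\<theta>. autocorrelation ?h \<theta> * g \<theta>)"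
    unfolding autocorrelation_def mult.assoc[symmetric] by simp
  also have "\<dots> = 2 * integral {0..pi} (\<lambda>\<theta>. autocorrelation ?h \<theta> * g \<theta>)"
    by (rule integral_even_period)
      (simp_all add: continuous_on_mult continuous_on_autocorrelation hc g autocorrelation_even autocorrelation_periodic support_fun_periodic)
  finally show "(LINT z : ?L \<times> ?L | lborel. g (snd (snd z) - snd (fst z))) = 2 * integral {0..pi} (\<lambda>\<theta>. autocorrelation ?h \<theta> * g \<theta>)" .
qed

theorem proposition8:
  fixes K :: "(real^2) set" and m :: nat
  assumes "compact K" and "convex K" and "C2_boundary K" and "0 \<in> interior K" and "m \<ge> 3"
  shows "let v = (\<lambda>P. sin (visual_angle K P) ^ m);
             f = (\<lambda>((p\<^sub>1, \<phi>\<^sub>1), (p\<^sub>2, \<phi>\<^sub>2)).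
                   real m * (real m - 1) * \<bar>sin (\<phi>\<^sub>2 - \<phi>\<^sub>1) ^ (m - 3)\<bar>
                   - (real m)\<^sup>2 * \<bar>sin (\<phi>\<^sub>2 - \<phi>\<^sub>1) ^ (m - 1)\<bar>)
         in set_integrable lborel (- K) v \<and>
            set_integrable lborel (lines_meeting K \<times> lines_meeting K) f \<and>
            2 * (LINT P : - K | lborel. v P)
              = (LINT G : lines_meeting K \<times> lines_meeting K | lborel. f G)"
proof -
  obtain \<gamma> \<nu> \<nu>' \<sigma> where "convex_oval K \<gamma> \<nu> \<nu>' \<sigma>"
    using C2_boundary_imp_convex_oval[OF assms(1-4)] by blast
  then interpret convex_oval K \<gamma> \<nu> \<nu>' \<sigma> .
  define n where "n = m - 3"
  have m: "m = n + 3" using assms(5) by (simp add: n_def)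
  let ?g = "\<lambda>\<theta>. real m * (real m - 1) * \<bar>sin \<theta> ^ (m - 3)\<bar> - (real m)\<^sup>2 * \<bar>sin \<theta> ^ (m - 1)\<bar>"
  let ?f = "\<lambda>((p\<^sub>1, \<phi>\<^sub>1), (p\<^sub>2, \<phi>\<^sub>2)). real m * (real m - 1) * \<bar>sin (\<phi>\<^sub>2 - \<phi>\<^sub>1) ^ (m - 3)\<bar>
                   - (real m)\<^sup>2 * \<bar>sin (\<phi>\<^sub>2 - \<phi>\<^sub>1) ^ (m - 1)\<bar>"
  have f: "?f = (\<lambda>z::(real \<times> real) \<times> (real \<times> real). ?g (snd (snd z) - snd (fst z)))"
    by (simp add: fun_eq_iff split_beta)
  have g1: "continuous_on UNIV ?g" by (intro continuous_intros)
  have g2: "?g (x + 2 * pi) = ?g x" for x by simp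
  have g3: "?g (- x) = ?g x" for x by (simp add: power_abs)
  have g4: "\<bar>?g x\<bar> \<le> real m * (real m - 1) + (real m)\<^sup>2" for x
  proof -
    have "\<bar>sin x ^ k\<bar> \<le> 1" for k by (simp add: power_abs power_le_one)
    then have "real m * (real m - 1) * \<bar>sin x ^ (m - 3)\<bar> \<le> real m * (real m - 1) * 1"
      "(real m)\<^sup>2 * \<bar>sin x ^ (m - 1)\<bar> \<le> (real m)\<^sup>2 * 1"
      using assms(5) by (intro mult_left_mono; simp)+
    moreover have "0 \<le> real m * (real m - 1) * \<bar>sin x ^ (m - 3)\<bar>" "0 \<le> (real m)\<^sup>2 * \<bar>sin x ^ (m - 1)\<bar>"
      using assms(5) by (intro mult_nonneg_nonneg; simp)+
    moreover have "\<bar>a - b\<bar> \<le> X + Y" if "a \<le> X * 1" "b \<le> Y * 1" "0 \<le> a" "0 \<le> b" for a b X Y :: real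
      using that by linarith
    ultimately show ?thesis by blast
  qed
  note pairs = line_pairs_integral[OF assms(1,2,4) g1 g2 g3 g4]
  \<comment> \<open>on \<open>[0, \<pi>]\<close> the sine is nonnegative, so the absolute values disappear\<close>
  have g_pos: "?g \<theta> = real m * (real (n + 2) * sin \<theta> ^ n - real (n + 3) * sin \<theta> ^ (n + 2))" if "\<theta> \<in> {0..pi}" for \<theta>
    using that sin_ge_zero[of \<theta>] by (simp add: m power2_eq_square algebra_simps)
  have "(LINT P : - K | lborel. sin (visual_angle K P) ^ m)
      = real m * integral {0..pi} (\<lambda>\<theta>. autocorrelation h \<theta> * (real (n + 2) * sin \<theta> ^ n - real (n + 3) * sin \<theta> ^ (n + 2)))"
    unfolding exterior_integral_eq(2)[OF assms(5)] n_def[symmetric] mean_square_gap_integral by simp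
  also have "\<dots> = integral {0..pi} (\<lambda>\<theta>. real m * (autocorrelation h \<theta> * (real (n + 2) * sin \<theta> ^ n - real (n + 3) * sin \<theta> ^ (n + 2))))"
    by simp
  also have "\<dots> = integral {0..pi} (\<lambda>\<theta>. autocorrelation h \<theta> * ?g \<theta>)"
    by (intro Henstock_Kurzweil_Integration.integral_cong) (simp only: g_pos mult.left_commute)
  finally have "2 * (LINT P : - K | lborel. sin (visual_angle K P) ^ m)
      = (LINT G : lines_meeting K \<times> lines_meeting K | lborel. ?f G)"
    unfolding f pairs(2) by simp
  then show ?thesis
    unfolding Let_def using exterior_integral_eq(1)[OF assms(5)] pairs(1) unfolding f by blast
qed

end
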